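(* Let $k$ be a field, let $q\in k^{\times}$ be not a root of unity, and let $n\ge 0$ be an integer. If $f\in A^{(n)}$ is bi-homogeneous and its image in the commutative polynomial ring $A_c^{(n)}$ is irreducible, then the two-sided ideal $\langle f\rangle\subset A^{(n)}$ generated by $f$ is prime.
   Context: Let $B^{(n)}=k\langle x,x',\dots,x^{(n)},y,y',\dots,y^{(n)}\rangle$ be the free associative (noncommutative) unital $k$-algebra on the $2n+2$ indeterminates $x=x^{(0)},x'=x^{(1)},\dots,x^{(n)},y=y^{(0)},y'=y^{(1)},\dots,y^{(n)}$. Let $A^{(n)}$ be the quotient of $B^{(n)}$ by the two-sided ideal generated by all elements $x^{(i)}x^{(j)}-x^{(j)}x^{(i)}$, $\;y^{(i)}y^{(j)}-y^{(j)}y^{(i)}$, $\;y^{(i)}x^{(j)}-q\,x^{(j)}y^{(i)}$ for $0\le i,j\le n$. Let $A_c^{(n)}=k[x,x',\dots,x^{(n)},y,y',\dots,y^{(n)}]$ be the usual commutative polynomial ring. The sets $A^{(n)}$ and $A_c^{(n)}$ are identified via the unique $k$-linear bijection sending the class in $A^{(n)}$ of each ordered monomial $x^{i_0}(x')^{i_1}\cdots(x^{(n)})^{i_n}y^{j_0}(y')^{j_1}\cdots(y^{(n)})^{j_n}$ to the same monomial in $A_c^{(n)}$ (this is not a ring isomorphism); the image of $f$ in $A_c^{(n)}$ is taken under this bijection. The bi-degree of such a monomial is $(i_0+\dots+i_n,\;j_0+\dots+j_n)$. An element of $A^{(n)}$ (or $A_c^{(n)}$) is bi-homogeneous if it is a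 $k$-linear combination of such monomials all of the same bi-degree. An ideal $P$ is prime if $P\ne(1)$ and $ab\in P$ implies $a\in P$ or $b\in P$ for all elements $a,b$. *)

theory Defs
  imports
    "HOL-Library.Poly_Mapping"
    "HOL-Algebra.QuotRing"
    "HOL-Algebra.Ring_Divisibility"
begin

(* XVar i is the indeterminate x^{(i)}, YVar i is y^{(i)}. *)
datatype indet = XVar nat | YVar nat

definition indets :: "nat \<Rightarrow> indet set" where
  "indets n = XVar ` {..n} \<union> YVar ` {..n}"


(* The free monoid, written additively because the convolution product of
   Poly_Mapping needs an additive monoid of exponents. *)
datatype 'a free_monoid = FM (letters: "'a list")

instantiation free_monoid :: (type) monoid_add
begin

definition zero_free_monoid :: "'a free_monoid" where
  "0 = FM []"

definition plus_free_monoid :: "'a free_monoid \<Rightarrow> 'a free_monoid \<Rightarrow> 'a free_monoid" where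
  "u + v = FM (letters u @ letters v)"

instance
  by standard (simp_all add: zero_free_monoid_def plus_free_monoid_def)

end

lemma letters_plus [simp]: "letters (u + v) = letters u @ letters v"
  by (simp add: plus_free_monoid_def)

lemma letters_zero [simp]: "letters 0 = []"
  by (simp add: zero_free_monoid_def)


definition free_alg :: "nat \<Rightarrow> (indet free_monoid \<Rightarrow>\<^sub>0 'k::field) ring" where
  "free_alg n =
    \<lparr>carrier = {p. \<forall>w \<in> Poly_Mapping.keys p. set (letters w) \<subseteq> indets n},
     mult = (*), one = 1, zero = 0, add = (+)\<rparr>"

definition poly_alg :: "nat \<Rightarrow> ((indet \<Rightarrow>\<^sub>0 nat) \<Rightarrow>\<^sub>0 'k::field) ring" where
  "poly_alg n =
    \<lparr>carrier = {p. \<forall>m \<in> Poly_Mapping.keys p. Poly_Mapping.keys m \<subseteq> indets n},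
     mult = (*), one = 1, zero = 0, add = (+)\<rparr>"

definition gen :: "indet \<Rightarrow> (indet free_monoid \<Rightarrow>\<^sub>0 'k::field)" where
  "gen v = Poly_Mapping.single (FM [v]) 1"

definition scalar :: "'k::field \<Rightarrow> (indet free_monoid \<Rightarrow>\<^sub>0 'k)" where
  "scalar c = Poly_Mapping.single 0 c"

definition q_relations :: "'k::field \<Rightarrow> nat \<Rightarrow> (indet free_monoid \<Rightarrow>\<^sub>0 'k) set" where
  "q_relations q n =
     {gen (XVar i) * gen (XVar j) - gen (XVar j) * gen (XVar i) | i j. i \<le> n \<and> j \<le> n} \<union>
     {gen (YVar i) * gen (YVar j) - gen (YVar j) * gen (YVar i) | i j. i \<le> n \<and> j \<le> n} \<union>
     {gen (YVar i) * gen (XVar j) - scalar q * (gen (XVar j) * gen (YVar i)) | i j. i \<le> n \<and> j \<le> n}"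

(* Idl in HOL-Algebra generates two-sided ideals. *)
definition q_ideal :: "'k::field \<Rightarrow> nat \<Rightarrow> (indet free_monoid \<Rightarrow>\<^sub>0 'k) set" where
  "q_ideal q n = Idl\<^bsub>free_alg n\<^esub> (q_relations q n)"

definition q_alg :: "'k::field \<Rightarrow> nat \<Rightarrow> (indet free_monoid \<Rightarrow>\<^sub>0 'k) set ring" where
  "q_alg q n = free_alg n Quot q_ideal q n"


(* x^{i_0} (x')^{i_1} ... (x^{(n)})^{i_n} y^{j_0} (y')^{j_1} ... (y^{(n)})^{j_n} as a word *)
definition ordered_word :: "nat \<Rightarrow> (indet \<Rightarrow>\<^sub>0 nat) \<Rightarrow> indet free_monoid" where
  "ordered_word n m = FM
     (concat (map (\<lambda>i. replicate (Poly_Mapping.lookup m (XVar i)) (XVar i)) [0..<Suc n]) @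
      concat (map (\<lambda>i. replicate (Poly_Mapping.lookup m (YVar i)) (YVar i)) [0..<Suc n]))"

definition ordered_rep ::
    "nat \<Rightarrow> ((indet \<Rightarrow>\<^sub>0 nat) \<Rightarrow>\<^sub>0 'k::field) \<Rightarrow> (indet free_monoid \<Rightarrow>\<^sub>0 'k)" where
  "ordered_rep n p =
     (\<Sum>m \<in> Poly_Mapping.keys p. Poly_Mapping.single (ordered_word n m) (Poly_Mapping.lookup p m))"

(* The k-linear map sending every commutative monomial to the class of the
   corresponding ordered monomial. For nonzero q it is a bijection from the
   carrier of poly_alg n onto that of q_alg q n; from_q_alg is the inverse bijection. *)
definition to_q_alg ::
    "'k::field \<Rightarrow> nat \<Rightarrow> ((indet \<Rightarrow>\<^sub>0 nat) \<Rightarrow>\<^sub>0 'k) \<Rightarrow> (indet free_monoid \<Rightarrow>\<^sub>0 'k) set" where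
  "to_q_alg q n p = q_ideal q n +>\<^bsub>free_alg n\<^esub> ordered_rep n p"

definition from_q_alg ::
    "'k::field \<Rightarrow> nat \<Rightarrow> (indet free_monoid \<Rightarrow>\<^sub>0 'k) set \<Rightarrow> ((indet \<Rightarrow>\<^sub>0 nat) \<Rightarrow>\<^sub>0 'k)" where
  "from_q_alg q n = inv_into (carrier (poly_alg n)) (to_q_alg q n)"

definition bidegree :: "nat \<Rightarrow> (indet \<Rightarrow>\<^sub>0 nat) \<Rightarrow> nat \<times> nat" where
  "bidegree n m =
     (\<Sum>i\<le>n. Poly_Mapping.lookup m (XVar i), \<Sum>i\<le>n. Poly_Mapping.lookup m (YVar i))"

definition bihomogeneous ::
    "'k::field \<Rightarrow> nat \<Rightarrow> (indet free_monoid \<Rightarrow>\<^sub>0 'k) set \<Rightarrow> bool" where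
  "bihomogeneous q n f \<longleftrightarrow>
     (\<exists>d. \<exists>p \<in> carrier (poly_alg n).
        (\<forall>m \<in> Poly_Mapping.keys p. bidegree n m = d) \<and> f = to_q_alg q n p)"

(* The primeideal locale of HOL-Algebra assumes a commutative ring, so the
   elementwise notion of a prime two-sided ideal is restated here. *)
definition prime_two_sided_ideal :: "'a set \<Rightarrow> ('a, 'b) ring_scheme \<Rightarrow> bool" where
  "prime_two_sided_ideal P R \<longleftrightarrow>
     ideal P R \<and> P \<noteq> carrier R \<and>
     (\<forall>a \<in> carrier R. \<forall>b \<in> carrier R. a \<otimes>\<^bsub>R\<^esub> b \<in> P \<longrightarrow> a \<in> P \<or> b \<in> P)"


(* Idl is only meaningful over a ring, so free_alg n and q_alg q n have to be rings. *)

lemma keys_mult_subset: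
  "Poly_Mapping.keys (p * p') \<subseteq> {u + v | u v. u \<in> Poly_Mapping.keys p \<and> v \<in> Poly_Mapping.keys p'}"
  using keys_mult[of p p'] by blast

lemma ring_free_alg: "ring (free_alg n :: (indet free_monoid \<Rightarrow>\<^sub>0 'k::field) ring)"
proof (rule ringI)
  let ?R = "free_alg n :: (indet free_monoid \<Rightarrow>\<^sub>0 'k) ring"
  show "abelian_group ?R"
  proof (rule abelian_groupI)
    show "\<And>x y. x \<in> carrier ?R \<Longrightarrow> y \<in> carrier ?R \<Longrightarrow> x \<oplus>\<^bsub>?R\<^esub> y \<in> carrier ?R"
      using Poly_Mapping.keys_add by (fastforce simp: free_alg_def)
    show "\<exists>y\<in>carrier ?R. y \<oplus>\<^bsub>?R\<^esub> x = \<zero>\<^bsub>?R\<^esub>" if "x \<in> carrier ?R" for x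
      using that by (intro bexI[of _ "- x"]) (auto simp: free_alg_def)
  qed (auto simp: free_alg_def algebra_simps)
  show "Group.monoid ?R"
  proof (rule Group.monoidI)
    show "x \<otimes>\<^bsub>?R\<^esub> y \<in> carrier ?R" if "x \<in> carrier ?R" "y \<in> carrier ?R" for x y
      using that keys_mult_subset[of x y] by (fastforce simp: free_alg_def)
  qed (auto simp: free_alg_def mult.assoc)
qed (auto simp: free_alg_def algebra_simps)

lemma q_relations_subset: "q_relations q n \<subseteq> carrier (free_alg n)"
proof -
  interpret ring "free_alg n :: (indet free_monoid \<Rightarrow>\<^sub>0 'a) ring" by (rule ring_free_alg)
  have minus: "a - b \<in> carrier (free_alg n)"
    if "a \<in> carrier (free_alg n)" "b \<in> carrier (free_alg n)" for a b :: "indet free_monoid \<Rightarrow>\<^sub>0 'a"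
    using that Poly_Mapping.keys_diff[of a b] by (auto simp: free_alg_def)
  have mult: "a * b \<in> carrier (free_alg n)"
    if "a \<in> carrier (free_alg n)" "b \<in> carrier (free_alg n)" for a b :: "indet free_monoid \<Rightarrow>\<^sub>0 'a"
    using m_closed[OF that] by (simp add: free_alg_def)
  have "gen v \<in> carrier (free_alg n)" if "v \<in> indets n" for v
    using that by (auto simp: free_alg_def gen_def)
  moreover have "scalar c \<in> carrier (free_alg n)" for c
    by (auto simp: free_alg_def scalar_def)
  ultimately show ?thesis
    unfolding q_relations_def by (auto simp: indets_def intro!: minus mult)
qed

lemma ideal_q_ideal: "ideal (q_ideal q n) (free_alg n)"
  unfolding q_ideal_def by (rule ring.genideal_ideal[OF ring_free_alg q_relations_subset])

lemma ring_q_alg: "ring (q_alg q n)"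
  unfolding q_alg_def by (rule ideal.quotient_is_ring[OF ideal_q_ideal])

end

theory Submission
  imports Defs "HOL-Computational_Algebra.Polynomial" "HOL-Library.Product_Lexorder"
begin

text \<open>
Write \<open>A\<close> for \<open>q_alg q n\<close> and identify it with the polynomial ring
\<open>A\<^sub>c\<close>, that is \<open>poly_alg n\<close>, through ordered monomials. The product of \<open>A\<close> then becomes a twisted product \<open>\<star>\<close> on polynomials:
monomials \<open>m\<close> and \<open>m'\<close> multiply to \<open>q\<close> to the power (degree of \<open>m\<close> in the
\<open>y\<close>'s times degree of \<open>m'\<close> in the \<open>x\<close>'s) times their ordinary product. That this is
an isomorphism rests on \<open>q_ideal_eq_kernel\<close>: sorting words is a homomorphism onto the twisted
ring whose kernel is exactly the ideal of relations.

On bi-homogeneous elements the twist is a constant, nonzero because \<open>q\<close> is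
(\<open>twisted_mult_bihomogeneous\<close>). Hence for bi-homogeneous \<open>f\<close> the two-sided ideal generated by
\<open>f\<close> is, as a set of polynomials, the ordinary principal ideal \<open>f A\<^sub>c\<close>
(\<open>genideal_eq_multiples\<close>). An irreducible \<open>f\<close> generates a prime ideal of \<open>A\<^sub>c\<close>, because
polynomial rings over a field are factorial (\<open>factorial_polys_on\<close>, obtained from Gauss's lemma
\<open>factorial_polys_in\<close> by adjoining one indeterminate at a time).

It remains to pass from the ordinary product to the twisted one (\<open>multiples_prime\<close>). The ideal is
graded by bi-degree. Order bi-degrees lexicographically; the top component of \<open>a \<star> b\<close> is a
nonzero scalar times the ordinary product of the top components of \<open>a\<close> and \<open>b\<close>. If
\<open>a \<star> b\<close> lies in the ideal, so does the top component of \<open>a\<close> or of \<open>b\<close>; remove it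
and repeat.
\<close>

section \<open>Unique factorization over polynomial rings\<close>

text \<open>The number of indeterminates varies in the induction that makes \<open>k[x\<^sub>1, \<dots>]\<close>
factorial, so the rings involved have to be subsets of one ambient domain. Divisibility, units,
irreducibles and primes are therefore taken relative to a subset \<open>S\<close>.\<close>

definition divides_in :: "'a::comm_ring_1 set \<Rightarrow> 'a \<Rightarrow> 'a \<Rightarrow> bool" where
  "divides_in S a b \<longleftrightarrow> (\<exists>c\<in>S. b = a * c)"

definition unit_in :: "'a::comm_ring_1 set \<Rightarrow> 'a \<Rightarrow> bool" where
  "unit_in S u \<longleftrightarrow> u \<in> S \<and> (\<exists>v\<in>S. u * v = 1)"

definition irreducible_in :: "'a::comm_ring_1 set \<Rightarrow> 'a \<Rightarrow> bool" where
  "irreducible_in S p \<longleftrightarrow> p \<in> S \<and> p \<noteq> 0 \<and> \<not> unit_in S p \<and>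
     (\<forall>a\<in>S. \<forall>b\<in>S. p = a * b \<longrightarrow> unit_in S a \<or> unit_in S b)"

definition prime_in :: "'a::comm_ring_1 set \<Rightarrow> 'a \<Rightarrow> bool" where
  "prime_in S p \<longleftrightarrow> (\<forall>a\<in>S. \<forall>b\<in>S. divides_in S p (a * b) \<longrightarrow> divides_in S p a \<or> divides_in S p b)"

locale sub_idom =
  fixes S :: "'a::idom set"
  assumes zero_in [simp]: "0 \<in> S" and one_in [simp]: "1 \<in> S"
    and add_in: "a \<in> S \<Longrightarrow> b \<in> S \<Longrightarrow> a + b \<in> S"
    and mult_in: "a \<in> S \<Longrightarrow> b \<in> S \<Longrightarrow> a * b \<in> S"
    and uminus_in: "a \<in> S \<Longrightarrow> - a \<in> S"
begin

lemma diff_in: "a \<in> S \<Longrightarrow> b \<in> S \<Longrightarrow> a - b \<in> S"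
  using add_in[of a "- b"] uminus_in[of b] by simp

lemma sum_in: "(\<And>i. i \<in> I \<Longrightarrow> f i \<in> S) \<Longrightarrow> sum f I \<in> S"
  by (induction I rule: infinite_finite_induct) (auto intro: add_in)

end

text \<open>Unique factorization in a form that passes to polynomials. The function \<open>\<delta>\<close> plays the
part of the number of irreducible factors: being additive and vanishing at units only, it bounds the
length of every factorization, hence factorizations into irreducibles exist. Over polynomials, the
degree plus \<open>\<delta>\<close> of the leading coefficient takes its place.\<close>

locale factorial_sub_idom = sub_idom S for S :: "'a::idom set" +
  assumes factor_count: "\<exists>\<delta>::'a \<Rightarrow> nat.
      (\<forall>a\<in>S. \<forall>b\<in>S. a \<noteq> 0 \<longrightarrow> b \<noteq> 0 \<longrightarrow> \<delta> (a * b) = \<delta> a + \<delta> b) \<and>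
      (\<forall>a\<in>S. a \<noteq> 0 \<longrightarrow> \<delta> a = 0 \<longrightarrow> unit_in S a)"
    and irreducible_imp_prime_in: "irreducible_in S p \<Longrightarrow> prime_in S p"

definition polys_in :: "'a::comm_ring_1 set \<Rightarrow> 'a poly set" where
  "polys_in S = {p. \<forall>i. coeff p i \<in> S}"

context sub_idom
begin

lemma polys_in_const: "[:c:] \<in> polys_in S \<longleftrightarrow> c \<in> S"
  by (auto simp: polys_in_def coeff_pCons split: nat.splits)

lemma polys_in_smult: "c \<in> S \<Longrightarrow> p \<in> polys_in S \<Longrightarrow> smult c p \<in> polys_in S"
  by (auto simp: polys_in_def intro: mult_in)

lemma polys_in_monom: "c \<in> S \<Longrightarrow> monom c i \<in> polys_in S"
  by (auto simp: polys_in_def)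

lemma polys_in_lead_coeff: "p \<in> polys_in S \<Longrightarrow> lead_coeff p \<in> S"
  by (auto simp: polys_in_def)

lemma sub_idom_polys_in: "sub_idom (polys_in S)"
proof
  show "a * b \<in> polys_in S" if "a \<in> polys_in S" "b \<in> polys_in S" for a b
    using that by (auto simp: polys_in_def coeff_mult intro!: sum_in mult_in)
qed (auto simp: polys_in_def add_in uminus_in coeff_pCons split: nat.splits)

lemma unit_in_polys_in_iff: "unit_in (polys_in S) u \<longleftrightarrow> (\<exists>c. u = [:c:] \<and> unit_in S c)"
proof
  assume "unit_in (polys_in S) u"
  then obtain v where uv: "u \<in> polys_in S" "v \<in> polys_in S" "u * v = 1"
    by (auto simp: unit_in_def)
  then have "u \<noteq> 0" "v \<noteq> 0" by auto
  with uv have "degree u + degree v = 0"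
    by (metis degree_1 degree_mult_eq)
  then obtain c d where cd: "u = [:c:]" "v = [:d:]"
    by (metis add_is_0 degree_eq_zeroE)
  with uv(3) have "c * d = 1" by (simp add: one_pCons mult.commute)
  with uv cd show "\<exists>c. u = [:c:] \<and> unit_in S c"
    by (auto simp: unit_in_def polys_in_const)
next
  assume "\<exists>c. u = [:c:] \<and> unit_in S c"
  then obtain c d where "u = [:c:]" "c \<in> S" "d \<in> S" "c * d = 1" by (auto simp: unit_in_def)
  then have "u * [:d:] = 1" "[:d:] \<in> polys_in S" "u \<in> polys_in S"
    by (auto simp: one_pCons polys_in_const mult.commute)
  then show "unit_in (polys_in S) u" unfolding unit_in_def by blast
qed

text \<open>The quotients of the coefficients vanish beyond the degree as soon as \<open>c \<noteq> 0\<close>, so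
they form a polynomial; for \<open>c = 0\<close> both sides say \<open>p = 0\<close>.\<close>

lemma divides_in_polys_in_const_iff:
  assumes "c \<in> S"
  shows "divides_in (polys_in S) [:c:] p \<longleftrightarrow> (\<forall>i. divides_in S c (coeff p i))"
proof -
  interpret polys: sub_idom "polys_in S" by (rule sub_idom_polys_in)
  show ?thesis
  proof
    assume "divides_in (polys_in S) [:c:] p"
    then show "\<forall>i. divides_in S c (coeff p i)"
      by (auto simp: divides_in_def polys_in_def)
  next
    assume R: "\<forall>i. divides_in S c (coeff p i)"
    show "divides_in (polys_in S) [:c:] p"
    proof (cases "c = 0")
      case True
      then have "p = 0" using R by (auto simp: divides_in_def poly_eq_iff)
      then show ?thesis using polys.zero_in by (auto simp: divides_in_def)
    next
      case False
      from R obtain g where g: "\<And>i. g i \<in> S" "\<And>i. coeff p i = c * g i"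
        unfolding divides_in_def by metis
      have "g i = 0" if "i > degree p" for i
        using g(2)[of i] that False by (simp add: coeff_eq_0)
      then have "coeff (Abs_poly g) = g"
        by (intro coeff_Abs_poly) auto
      then have "Abs_poly g \<in> polys_in S" "p = [:c:] * Abs_poly g"
        using g by (auto simp: polys_in_def poly_eq_iff)
      then show ?thesis by (auto simp: divides_in_def)
    qed
  qed
qed

lemma divides_in_diff:
  "divides_in S a b \<Longrightarrow> divides_in S a c \<Longrightarrow> divides_in S a (b - c)"
  unfolding divides_in_def by (metis diff_in right_diff_distrib)

lemma divides_in_add:
  "divides_in S a b \<Longrightarrow> divides_in S a c \<Longrightarrow> divides_in S a (b + c)"
  unfolding divides_in_def by (metis add_in distrib_left)

lemma divides_in_mult:
  "divides_in S a b \<Longrightarrow> c \<in> S \<Longrightarrow> divides_in S a (b * c)"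
  unfolding divides_in_def by (metis mult.assoc mult_in)

lemma divides_in_mult2:
  "divides_in S a b \<Longrightarrow> c \<in> S \<Longrightarrow> divides_in S a (c * b)"
  using divides_in_mult[of a b c] by (simp add: mult.commute)

lemma degree_diff_lead_monom_less:
  fixes p :: "'a poly"
  assumes "p - monom (lead_coeff p) (degree p) \<noteq> 0"
  shows "degree (p - monom (lead_coeff p) (degree p)) < degree p"
proof -
  let ?r = "p - monom (lead_coeff p) (degree p)"
  have le: "degree ?r \<le> degree p" by (simp add: degree_diff_le degree_monom_le)
  have "coeff ?r (degree p) = 0" by simp
  with assms have "degree ?r \<noteq> degree p" using leading_coeff_0_iff by metis
  with le show ?thesis by linarith
qed

text \<open>If a prime constant \<open>c\<close> divides \<open>a * b\<close>, it divides the product of the two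
leading coefficients, hence one of them. Deleting that leading term changes neither the hypothesis nor
the divisibility of the factor by \<open>c\<close>, and induction on the degrees finishes.\<close>

lemma prime_in_const_poly:
  assumes c: "c \<in> S" "prime_in S c"
  shows "prime_in (polys_in S) [:c:]"
proof -
  interpret polys: sub_idom "polys_in S" by (rule sub_idom_polys_in)
  let ?d = "divides_in (polys_in S) [:c:]"
  have d0: "?d 0" using polys.zero_in by (auto simp: divides_in_def)
  have "?d a \<or> ?d b" if "a \<in> polys_in S" "b \<in> polys_in S" "?d (a * b)" for a b
    using that
  proof (induction "degree a + degree b" arbitrary: a b rule: less_induct)
    case less
    show ?case
    proof (cases "a = 0 \<or> b = 0")
      case True
      then show ?thesis using d0 by auto
    next
      case False
      have zero_divisible: "divides_in S c 0" unfolding divides_in_def by (intro bexI[of _ 0]) simp_all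
      have lead: "?d (monom (lead_coeff u) (degree u))" if "divides_in S c (lead_coeff u)" for u
        using that zero_divisible unfolding divides_in_polys_in_const_iff[OF c(1)] by simp
      have restore: "?d u" if "?d (monom (lead_coeff u) (degree u))"
        and "?d (u - monom (lead_coeff u) (degree u))" for u
        using polys.divides_in_add[OF that] by simp
      have "divides_in S c (coeff (a * b) (degree a + degree b))"
        using less.prems(3) by (simp add: divides_in_polys_in_const_iff[OF c(1)])
      then have "divides_in S c (lead_coeff a * lead_coeff b)"
        by (simp add: coeff_mult_degree_sum)
      then consider "divides_in S c (lead_coeff a)" | "divides_in S c (lead_coeff b)"
        using c(2) polys_in_lead_coeff[OF less.prems(1)] polys_in_lead_coeff[OF less.prems(2)]
        unfolding prime_in_def by blast
      then show ?thesis
      proof cases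
        case 1
        let ?a = "a - monom (lead_coeff a) (degree a)"
        have m: "?d (monom (lead_coeff a) (degree a))" using 1 by (rule lead)
        have a_in: "?a \<in> polys_in S"
          using less.prems by (intro polys.diff_in polys_in_monom polys_in_lead_coeff)
        have "?d (?a * b)"
          using less.prems m
          by (auto simp: left_diff_distrib intro!: polys.divides_in_diff polys.divides_in_mult)
        then have "?d ?a \<or> ?d b"
          using less.hyps[of ?a b] a_in less.prems degree_diff_lead_monom_less[of a] d0
          by (cases "?a = 0") auto
        then show ?thesis using restore[OF m] by blast
      next
        case 2
        let ?b = "b - monom (lead_coeff b) (degree b)"
        have m: "?d (monom (lead_coeff b) (degree b))" using 2 by (rule lead)
        have b_in: "?b \<in> polys_in S"
          using less.prems by (intro polys.diff_in polys_in_monom polys_in_lead_coeff)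
        have "?d (a * ?b)"
          using less.prems m
          by (auto simp: right_diff_distrib intro!: polys.divides_in_diff polys.divides_in_mult2)
        then have "?d a \<or> ?d ?b"
          using less.hyps[of a ?b] b_in less.prems degree_diff_lead_monom_less[of b] d0
          by (cases "?b = 0") auto
        then show ?thesis using restore[OF m] by blast
      qed
    qed
  qed
  then show ?thesis by (auto simp: prime_in_def)
qed

text \<open>Long division without division in \<open>S\<close>: before each step \<open>g\<close> is multiplied by the
leading coefficient of \<open>r\<close>, and \<open>c\<close> collects these factors.\<close>

lemma pseudo_division:
  assumes r: "r \<in> polys_in S" "r \<noteq> 0" and g: "g \<in> polys_in S"
  shows "\<exists>c s t. c \<in> S \<and> c \<noteq> 0 \<and> s \<in> polys_in S \<and> t \<in> polys_in S \<and>
    smult c g = r * s + t \<and> (t = 0 \<or> degree t < degree r)"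
proof -
  interpret polys: sub_idom "polys_in S" by (rule sub_idom_polys_in)
  show ?thesis
    using g
  proof (induction "degree g" arbitrary: g rule: less_induct)
    case less
    show ?case
    proof (cases "g = 0 \<or> degree g < degree r")
      case True
      then show ?thesis
        using less.prems by (intro exI[of _ 1] exI[of _ 0] exI[of _ g]) auto
    next
      case False
      let ?m = "monom (lead_coeff g) (degree g - degree r)"
      let ?h = "smult (lead_coeff r) g - r * ?m"
      have m: "?m \<in> polys_in S" using less.prems by (intro polys_in_monom polys_in_lead_coeff)
      have h: "?h \<in> polys_in S"
        using less.prems r m by (intro polys.diff_in polys_in_smult polys.mult_in polys_in_lead_coeff)
      have g0: "lead_coeff g \<noteq> 0" using False by simp
      have deg: "degree (r * ?m) = degree g"
        using False r g0 by (simp add: degree_mult_eq degree_monom_eq)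
      have "coeff (r * ?m) (degree g) = lead_coeff r * lead_coeff g"
        using deg lead_coeff_mult[of r ?m] g0 by (simp add: degree_monom_eq)
      then have "coeff ?h (degree g) = 0" by simp
      moreover have "degree ?h \<le> degree g"
        using deg by (intro degree_diff_le) auto
      ultimately have small: "?h = 0 \<or> degree ?h < degree g"
        by (metis le_neq_implies_less leading_coeff_0_iff)
      have "\<exists>c s t. c \<in> S \<and> c \<noteq> 0 \<and> s \<in> polys_in S \<and> t \<in> polys_in S \<and>
        smult c ?h = r * s + t \<and> (t = 0 \<or> degree t < degree r)"
      proof (cases "?h = 0")
        case True
        then show ?thesis by (intro exI[of _ 1] exI[of _ 0] exI[of _ 0]) auto
      next
        case False
        then show ?thesis using less.hyps[of ?h] small h by auto
      qed
      then obtain c s t where cst: "c \<in> S" "c \<noteq> 0" "s \<in> polys_in S" "t \<in> polys_in S"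
        "smult c ?h = r * s + t" "t = 0 \<or> degree t < degree r" by blast
      have "smult (c * lead_coeff r) g = r * (s + smult c ?m) + t"
      proof -
        have "smult (c * lead_coeff r) g = smult c ?h + smult c (r * ?m)"
          by (simp add: smult_diff_right)
        then show ?thesis using cst(5) by (simp add: algebra_simps)
      qed
      moreover have "c * lead_coeff r \<in> S" "c * lead_coeff r \<noteq> 0" "s + smult c ?m \<in> polys_in S"
        using cst r m by (auto intro: mult_in polys_in_lead_coeff polys.add_in polys_in_smult)
      ultimately show ?thesis using cst by blast
    qed
  qed
qed

end

context factorial_sub_idom
begin

text \<open>Every nonzero element is a product of irreducibles and a unit: splitting off an irreducible factor
lowers \<open>\<delta>\<close>, and an element of least \<open>\<delta>\<close> among the nonunit factors is
irreducible.\<close>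

lemma irreducible_factor_induct [consumes 2, case_names unit factor]:
  assumes "c \<in> S" "c \<noteq> 0"
    and unit: "\<And>u. unit_in S u \<Longrightarrow> Q u"
    and factor: "\<And>\<pi> c. irreducible_in S \<pi> \<Longrightarrow> c \<in> S \<Longrightarrow> c \<noteq> 0 \<Longrightarrow> Q c \<Longrightarrow> Q (\<pi> * c)"
  shows "Q c"
proof -
  obtain \<delta> :: "'a \<Rightarrow> nat" where
    add: "\<And>a b. a \<in> S \<Longrightarrow> b \<in> S \<Longrightarrow> a \<noteq> 0 \<Longrightarrow> b \<noteq> 0 \<Longrightarrow> \<delta> (a * b) = \<delta> a + \<delta> b" and
    unit_if: "\<And>a. a \<in> S \<Longrightarrow> a \<noteq> 0 \<Longrightarrow> \<delta> a = 0 \<Longrightarrow> unit_in S a"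
    using factor_count by blast
  have ex: "\<exists>\<pi> b. irreducible_in S \<pi> \<and> b \<in> S \<and> a = \<pi> * b"
    if "a \<in> S" "a \<noteq> 0" "\<not> unit_in S a" for a
    using that
  proof (induction "\<delta> a" arbitrary: a rule: less_induct)
    case less
    show ?case
    proof (cases "irreducible_in S a")
      case True
      then show ?thesis by (intro exI[of _ a] exI[of _ 1]) auto
    next
      case False
      then obtain x y where xy: "x \<in> S" "y \<in> S" "a = x * y" "\<not> unit_in S x" "\<not> unit_in S y"
        using less.prems by (auto simp: irreducible_in_def)
      then have nz: "x \<noteq> 0" "y \<noteq> 0" using less.prems by auto
      with xy have "\<delta> x < \<delta> a" using add unit_if by fastforce
      then obtain \<pi> b where "irreducible_in S \<pi>" "b \<in> S" "x = \<pi> * b"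
        using less.hyps xy nz by blast
      with xy show ?thesis
        by (intro exI[of _ \<pi>] exI[of _ "b * y"]) (auto intro: mult_in simp: mult.assoc)
    qed
  qed
  show ?thesis
    using assms(1,2)
  proof (induction "\<delta> c" arbitrary: c rule: less_induct)
    case less
    show ?case
    proof (cases "unit_in S c")
      case False
      then obtain \<pi> b where b: "irreducible_in S \<pi>" "b \<in> S" "c = \<pi> * b"
        using ex less.prems by blast
      then have pi: "\<pi> \<in> S" "\<pi> \<noteq> 0" "\<not> unit_in S \<pi>" "b \<noteq> 0"
        using less.prems by (auto simp: irreducible_in_def)
      then have "\<delta> b < \<delta> c" using b add unit_if by fastforce
      then show ?thesis using less.hyps[of b] factor b pi by simp
    qed (rule unit)
  qed
qed

text \<open>Gauss's argument about contents without greatest common divisors: an irreducible factor of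
\<open>c\<close> is a prime constant, so it divides \<open>s\<close> or \<open>r\<close> and can be
cancelled there. In this way all of \<open>c\<close> is distributed over the two factors.\<close>

lemma smult_eq_mult_split:
  assumes "c \<in> S" "c \<noteq> 0" "g \<in> polys_in S" "s \<in> polys_in S" "r \<in> polys_in S"
    and "smult c g = s * r"
  shows "\<exists>c1 c2 s1 r1. c1 \<in> S \<and> c2 \<in> S \<and> s1 \<in> polys_in S \<and> r1 \<in> polys_in S \<and>
    s = smult c1 s1 \<and> r = smult c2 r1 \<and> g = s1 * r1"
  using assms
proof (induction c arbitrary: s r rule: irreducible_factor_induct)
  case (unit u)
  then obtain v where v: "u \<in> S" "v \<in> S" "u * v = 1" by (auto simp: unit_in_def)
  have "smult v (smult u g) = g" using v by (simp add: mult.commute)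
  then have "g = smult v s * r" using unit by simp
  moreover have "s = smult u (smult v s)" using v by simp
  ultimately show ?case
    using unit v by (intro exI[of _ u] exI[of _ 1] exI[of _ "smult v s"] exI[of _ r])
      (auto intro: polys_in_smult)
next
  case (factor \<pi> c)
  have pi: "\<pi> \<in> S" "\<pi> \<noteq> 0" using factor by (auto simp: irreducible_in_def)
  have cancel: "x = y" if "smult \<pi> x = smult \<pi> y" for x y :: "'a poly"
    using that pi by (simp add: poly_eq_iff)
  have const_mult: "[:\<pi>:] * x = smult \<pi> x" for x :: "'a poly" by simp
  have "prime_in (polys_in S) [:\<pi>:]"
    using factor pi by (intro prime_in_const_poly irreducible_imp_prime_in)
  moreover have "s * r = [:\<pi>:] * smult c g"
    unfolding const_mult smult_smult by (rule factor.prems(4)[symmetric])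
  then have "divides_in (polys_in S) [:\<pi>:] (s * r)"
    using polys_in_smult[OF factor.hyps(2) factor.prems(1)] unfolding divides_in_def by blast
  ultimately have "divides_in (polys_in S) [:\<pi>:] s \<or> divides_in (polys_in S) [:\<pi>:] r"
    using factor.prems(2,3) unfolding prime_in_def by blast
  then consider s' where "s' \<in> polys_in S" "s = smult \<pi> s'"
    | r' where "r' \<in> polys_in S" "r = smult \<pi> r'"
    unfolding divides_in_def const_mult by (elim disjE bexE)
  then show ?case
  proof cases
    case 1
    have "smult \<pi> (smult c g) = smult \<pi> (s' * r)" using 1 factor.prems by simp
    then have "smult c g = s' * r" using cancel by blast
    then obtain c1 c2 s1 r1 where "c1 \<in> S" "c2 \<in> S" "s1 \<in> polys_in S" "r1 \<in> polys_in S"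
      "s' = smult c1 s1" "r = smult c2 r1" "g = s1 * r1"
      using factor.IH[of s' r] factor.prems 1 by blast
    then show ?thesis
      using 1 pi by (intro exI[of _ "\<pi> * c1"] exI[of _ c2] exI[of _ s1] exI[of _ r1])
        (auto intro: mult_in)
  next
    case 2
    have "smult \<pi> (smult c g) = smult \<pi> (s * r')" using 2 factor.prems by simp
    then have "smult c g = s * r'" using cancel by blast
    then obtain c1 c2 s1 r1 where "c1 \<in> S" "c2 \<in> S" "s1 \<in> polys_in S" "r1 \<in> polys_in S"
      "s = smult c1 s1" "r' = smult c2 r1" "g = s1 * r1"
      using factor.IH[of s r'] factor.prems 2 by blast
    then show ?thesis
      using 2 pi by (intro exI[of _ c1] exI[of _ "\<pi> * c2"] exI[of _ s1] exI[of _ r1])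
        (auto intro: mult_in)
  qed
qed

text \<open>The only constant factors of an irreducible polynomial of positive degree are units. With
\<open>smult c a = p * u\<close> split as above, the constant that \<open>p\<close> loses must be a unit.\<close>

lemma divides_in_smult_cancel:
  assumes p: "irreducible_in (polys_in S) p" "degree p > 0"
    and c: "c \<in> S" "c \<noteq> 0" and a: "a \<in> polys_in S"
    and d: "divides_in (polys_in S) p (smult c a)"
  shows "divides_in (polys_in S) p a"
proof -
  from d obtain u where u: "u \<in> polys_in S" "smult c a = p * u" by (auto simp: divides_in_def)
  have p_in: "p \<in> polys_in S" using p by (simp add: irreducible_in_def)
  obtain c1 c2 p1 u1 where *: "c1 \<in> S" "c2 \<in> S" "p1 \<in> polys_in S" "u1 \<in> polys_in S"
    "p = smult c1 p1" "u = smult c2 u1" "a = p1 * u1"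
    using smult_eq_mult_split[OF c a p_in u] by blast
  have "\<not> unit_in (polys_in S) p1"
    using p(2) * by (auto simp: unit_in_polys_in_iff split: if_splits)
  moreover have "p = [:c1:] * p1" using * by simp
  moreover have "[:c1:] \<in> polys_in S" using * by (simp add: polys_in_const)
  ultimately have "unit_in (polys_in S) [:c1:]"
    using p(1) *(3) unfolding irreducible_in_def by blast
  then have "unit_in S c1" unfolding unit_in_polys_in_iff by simp
  then obtain v where v: "v \<in> S" "c1 * v = 1" unfolding unit_in_def by blast
  then have "p1 = smult v p" using * by (simp add: mult.commute)
  then have "a = smult v p * u1" using *(7) by (rule subst)
  then have "a = p * smult v u1" by (simp only: mult_smult_left mult_smult_right)
  then show ?thesis using v * by (auto simp: divides_in_def intro!: bexI[of _ "smult v u1"] polys_in_smult)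
qed

text \<open>Gauss's lemma without a field of fractions. Suppose \<open>p\<close> has positive degree and divides
\<open>a * b\<close> but not \<open>a\<close>. Let \<open>r \<noteq> 0\<close> have least degree in the ideal
\<open>I = (a, p)\<close>. Pseudo-division shows that \<open>r\<close> divides a constant multiple of every
element of \<open>I\<close>, in particular of \<open>p\<close>. As \<open>p\<close> is irreducible,
\<open>r\<close> is up to a constant either associated to \<open>p\<close> or a unit. In the first case
\<open>p\<close> divides a constant multiple of \<open>a\<close>, hence \<open>a\<close>. In the second,
\<open>r\<close> is a constant with \<open>r * b \<in> (a * b, p)\<close>, so \<open>p\<close> divides
\<open>r * b\<close> and hence \<open>b\<close>.\<close>

lemma irreducible_in_polys_in_imp_prime_in:
  assumes p: "irreducible_in (polys_in S) p"
  shows "prime_in (polys_in S) p"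
proof (cases "degree p = 0")
  case True
  then obtain c where c: "p = [:c:]" by (rule degree_eq_zeroE)
  have irr: "irreducible_in S c"
    unfolding irreducible_in_def
  proof (intro conjI ballI impI)
    show "c \<in> S" "c \<noteq> 0" "\<not> unit_in S c"
      using p c by (auto simp: irreducible_in_def polys_in_const unit_in_polys_in_iff)
    fix a b assume ab: "a \<in> S" "b \<in> S" "c = a * b"
    then have "p = [:a:] * [:b:]" "[:a:] \<in> polys_in S" "[:b:] \<in> polys_in S"
      using c by (auto simp: polys_in_const)
    then have "unit_in (polys_in S) [:a:] \<or> unit_in (polys_in S) [:b:]"
      using p unfolding irreducible_in_def by blast
    then show "unit_in S a \<or> unit_in S b" by (auto simp: unit_in_polys_in_iff)
  qed
  then show ?thesis
    unfolding c by (intro prime_in_const_poly irreducible_imp_prime_in) (simp_all add: irreducible_in_def)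
next
  case False
  interpret polys: sub_idom "polys_in S" by (rule sub_idom_polys_in)
  have p_in: "p \<in> polys_in S" and p0: "p \<noteq> 0" using p by (auto simp: irreducible_in_def)
  let ?d = "divides_in (polys_in S) p"
  have "?d b" if a: "a \<in> polys_in S" and b: "b \<in> polys_in S" and ab: "?d (a * b)" and na: "\<not> ?d a" for a b
  proof -
    define I where "I = {u * a + v * p | u v. u \<in> polys_in S \<and> v \<in> polys_in S}"
    have I_in: "I \<subseteq> polys_in S"
      unfolding I_def using a p_in by (auto intro!: polys.add_in polys.mult_in)
    have "p = 0 * a + 1 * p" "a = 1 * a + 0 * p" by simp_all
    then have p_I: "p \<in> I" and a_I: "a \<in> I"
      unfolding I_def using polys.zero_in polys.one_in by blast+
    obtain r where r: "r \<in> I" "r \<noteq> 0" and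
      least: "\<And>t. t \<in> I \<Longrightarrow> t \<noteq> 0 \<Longrightarrow> degree r \<le> degree t"
      using ex_has_least_nat[of "\<lambda>t. t \<in> I \<and> t \<noteq> 0" p degree] p_I p0 by blast
    \<comment> \<open>By minimality of the degree of \<open>r\<close>, the remainder, which lies in \<open>I\<close>, is 0.\<close>
    have multiple: "\<exists>c s. c \<in> S \<and> c \<noteq> 0 \<and> s \<in> polys_in S \<and> smult c g = r * s" if g: "g \<in> I" for g
    proof -
      obtain c s t where *: "c \<in> S" "c \<noteq> 0" "s \<in> polys_in S" "t \<in> polys_in S"
        "smult c g = r * s + t" "t = 0 \<or> degree t < degree r"
        using pseudo_division[of r g] r g I_in by blast
      have t: "t = smult c g - r * s" using * by simp
      obtain u v u' v' where **: "g = u * a + v * p" "r = u' * a + v' * p"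
        "u \<in> polys_in S" "v \<in> polys_in S" "u' \<in> polys_in S" "v' \<in> polys_in S"
        using g r unfolding I_def by auto
      have "t = (smult c u - u' * s) * a + (smult c v - v' * s) * p"
        unfolding t ** by (simp add: algebra_simps smult_add_right)
      moreover have "smult c u - u' * s \<in> polys_in S" "smult c v - v' * s \<in> polys_in S"
        using * ** by (auto intro!: polys.diff_in polys.mult_in polys_in_smult)
      ultimately have "t \<in> I" unfolding I_def by blast
      then have "t = 0" using * least by fastforce
      then show ?thesis using * by auto
    qed
    obtain c s where cs: "c \<in> S" "c \<noteq> 0" "s \<in> polys_in S" "smult c p = r * s"
      using multiple[OF p_I] by blast
    obtain c' s' where cs': "c' \<in> S" "c' \<noteq> 0" "s' \<in> polys_in S" "smult c' a = r * s'"
      using multiple[OF a_I] by blast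
    have r_in: "r \<in> polys_in S" using r I_in by blast
    obtain d e r1 s1 where *: "d \<in> S" "e \<in> S" "r1 \<in> polys_in S" "s1 \<in> polys_in S"
      "r = smult d r1" "s = smult e s1" "p = r1 * s1"
      using smult_eq_mult_split[OF cs(1,2) p_in r_in cs(3,4)] by blast
    then consider "unit_in (polys_in S) s1" | "unit_in (polys_in S) r1"
      using p unfolding irreducible_in_def by blast
    then show ?thesis
    proof cases
      case 1
      then obtain w where w: "w \<in> polys_in S" "s1 * w = 1" by (auto simp: unit_in_def)
      have "p * w = r1" using * w by (simp add: mult.assoc)
      then have "smult c' a = smult d (p * w * s')" using cs'(4) *(5) by simp
      then have "smult c' a = p * (w * smult d s')" by (simp only: mult.assoc mult_smult_right)
      moreover have "w * smult d s' \<in> polys_in S"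
        using w * cs' by (intro polys.mult_in polys_in_smult)
      ultimately have "?d (smult c' a)" unfolding divides_in_def by blast
      then have "?d a" using divides_in_smult_cancel[OF p] False cs' a by blast
      with na show ?thesis by simp
    next
      case 2
      then obtain e where e: "r = [:e:]" using * by (auto simp: unit_in_polys_in_iff)
      with r r_in have e': "e \<in> S" "e \<noteq> 0" by (auto simp: polys_in_const)
      obtain u v where uv: "r = u * a + v * p" "u \<in> polys_in S" "v \<in> polys_in S"
        using r unfolding I_def by auto
      have "smult e b = r * b" using e by simp
      also have "\<dots> = u * (a * b) + p * (v * b)" using uv by (simp add: algebra_simps)
      finally have eq: "smult e b = u * (a * b) + p * (v * b)" .
      have "?d (p * (v * b))" using uv b by (auto simp: divides_in_def intro!: polys.mult_in)
      then have "?d (smult e b)"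
        unfolding eq using ab uv(2) by (intro polys.divides_in_add polys.divides_in_mult2[of _ "a * b"])
      then show ?thesis using divides_in_smult_cancel[OF p] False e' b by blast
    qed
  qed
  then show ?thesis by (auto simp: prime_in_def)
qed

theorem factorial_polys_in: "factorial_sub_idom (polys_in S)"
proof -
  interpret polys: sub_idom "polys_in S" by (rule sub_idom_polys_in)
  show ?thesis
  proof
    obtain \<delta> :: "'a \<Rightarrow> nat" where
      add: "\<And>a b. a \<in> S \<Longrightarrow> b \<in> S \<Longrightarrow> a \<noteq> 0 \<Longrightarrow> b \<noteq> 0 \<Longrightarrow> \<delta> (a * b) = \<delta> a + \<delta> b" and
      unit_if: "\<And>a. a \<in> S \<Longrightarrow> a \<noteq> 0 \<Longrightarrow> \<delta> a = 0 \<Longrightarrow> unit_in S a"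
      using factor_count by blast
    let ?\<epsilon> = "\<lambda>p. degree p + \<delta> (lead_coeff p)"
    have e_mult: "?\<epsilon> (a * b) = ?\<epsilon> a + ?\<epsilon> b"
      if "a \<in> polys_in S" "b \<in> polys_in S" "a \<noteq> 0" "b \<noteq> 0" for a b
    proof -
      have "\<delta> (lead_coeff (a * b)) = \<delta> (lead_coeff a) + \<delta> (lead_coeff b)"
        using that add[of "lead_coeff a" "lead_coeff b"]
        by (simp only: lead_coeff_mult polys_in_lead_coeff leading_coeff_0_iff not_False_eq_True)
      then show ?thesis using degree_mult_eq[of a b] that by linarith
    qed
    have e_unit: "unit_in (polys_in S) a" if "a \<in> polys_in S" "a \<noteq> 0" "?\<epsilon> a = 0" for a
    proof -
      have "degree a = 0" using that by simp
      then obtain c where "a = [:c:]" by (rule degree_eq_zeroE)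
      then show ?thesis using that unit_if by (auto simp: unit_in_polys_in_iff polys_in_const)
    qed
    show "\<exists>\<delta>::'a poly \<Rightarrow> nat.
        (\<forall>a\<in>polys_in S. \<forall>b\<in>polys_in S. a \<noteq> 0 \<longrightarrow> b \<noteq> 0 \<longrightarrow> \<delta> (a * b) = \<delta> a + \<delta> b) \<and>
        (\<forall>a\<in>polys_in S. a \<noteq> 0 \<longrightarrow> \<delta> a = 0 \<longrightarrow> unit_in (polys_in S) a)"
      by (rule exI[of _ ?\<epsilon>], intro conjI ballI impI) (erule (3) e_mult, erule (2) e_unit)
  qed (rule irreducible_in_polys_in_imp_prime_in)
qed

end

section \<open>Polynomials in finitely many indeterminates\<close>

text \<open>Factoriality is transported along injective ring homomorphisms; \<open>h\<close> will be the evaluation of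
polynomials over \<open>k[V]\<close> at a new indeterminate.\<close>

lemma (in factorial_sub_idom) factorial_image:
  fixes h :: "'a \<Rightarrow> 'b::idom"
  assumes one: "h 1 = 1" and add: "\<And>a b. h (a + b) = h a + h b"
    and mult: "\<And>a b. h (a * b) = h a * h b"
    and kernel: "\<And>a. a \<in> S \<Longrightarrow> h a = 0 \<Longrightarrow> a = 0"
  shows "factorial_sub_idom (h ` S)"
proof -
  have zero: "h 0 = 0" using add[of 0 0] by (metis add_0_right add_left_cancel)
  have uminus: "h (- a) = - h a" for a using add[of a "- a"] zero by (simp add: add_eq_0_iff)
  have inj: "h a = h b \<longleftrightarrow> a = b" if "a \<in> S" "b \<in> S" for a b
    using kernel[of "a - b"] that add[of a "- b"] uminus[of b] by (auto intro: diff_in)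
  have eq0: "h a = 0 \<longleftrightarrow> a = 0" if "a \<in> S" for a using inj[of a 0] that zero by simp
  have unit: "unit_in (h ` S) (h u) \<longleftrightarrow> unit_in S u" if "u \<in> S" for u
    unfolding unit_in_def using that inj one_in mult_in by (auto simp flip: one mult)
  have dvd: "divides_in (h ` S) (h a) (h b) \<longleftrightarrow> divides_in S a b" if "a \<in> S" "b \<in> S" for a b
    unfolding divides_in_def using that inj mult_in by (auto simp flip: mult)
  interpret im: sub_idom "h ` S"
  proof
    show "0 \<in> h ` S" using zero zero_in by (metis imageI)
    show "1 \<in> h ` S" using one one_in by (metis imageI)
    show "a + b \<in> h ` S" if "a \<in> h ` S" "b \<in> h ` S" for a b
      using that add add_in by (auto simp: image_iff) metis
    show "a * b \<in> h ` S" if "a \<in> h ` S" "b \<in> h ` S" for a b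
      using that mult mult_in by (auto simp: image_iff) metis
    show "- a \<in> h ` S" if "a \<in> h ` S" for a
      using that uminus uminus_in by (auto simp: image_iff) metis
  qed
  obtain \<delta> :: "'a \<Rightarrow> nat" where
    \<delta>_mult: "\<And>a b. a \<in> S \<Longrightarrow> b \<in> S \<Longrightarrow> a \<noteq> 0 \<Longrightarrow> b \<noteq> 0 \<Longrightarrow> \<delta> (a * b) = \<delta> a + \<delta> b" and
    \<delta>_unit: "\<And>a. a \<in> S \<Longrightarrow> a \<noteq> 0 \<Longrightarrow> \<delta> a = 0 \<Longrightarrow> unit_in S a"
    using factor_count by blast
  define g where "g = inv_into S h"
  have g: "g (h a) = a" if "a \<in> S" for a
    unfolding g_def using that inj by (intro inv_into_f_f) (auto intro: inj_onI)
  show ?thesis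
  proof
    show "\<exists>\<delta>::'b \<Rightarrow> nat. (\<forall>a\<in>h ` S. \<forall>b\<in>h ` S. a \<noteq> 0 \<longrightarrow> b \<noteq> 0 \<longrightarrow> \<delta> (a * b) = \<delta> a + \<delta> b) \<and>
        (\<forall>a\<in>h ` S. a \<noteq> 0 \<longrightarrow> \<delta> a = 0 \<longrightarrow> unit_in (h ` S) a)"
    proof (rule exI[of _ "\<lambda>x. \<delta> (g x)"], intro conjI ballI impI)
      fix a b assume "a \<in> h ` S" "b \<in> h ` S" "a \<noteq> 0" "b \<noteq> 0"
      then show "\<delta> (g (a * b)) = \<delta> (g a) + \<delta> (g b)"
        using \<delta>_mult eq0 mult_in by (auto simp: g simp flip: mult)
    next
      fix a assume "a \<in> h ` S" "a \<noteq> 0" "\<delta> (g a) = 0"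
      then show "unit_in (h ` S) a" using \<delta>_unit eq0 unit by (auto simp: g)
    qed
  next
    fix p assume p: "irreducible_in (h ` S) p"
    then obtain p' where p': "p' \<in> S" "p = h p'" by (auto simp: irreducible_in_def)
    have "irreducible_in S p'"
      unfolding irreducible_in_def
    proof (intro conjI ballI impI)
      show "p' \<in> S" "p' \<noteq> 0" "\<not> unit_in S p'"
        using p p' eq0 unit by (auto simp: irreducible_in_def)
      fix a b assume ab: "a \<in> S" "b \<in> S" "p' = a * b"
      then have "p = h a * h b" using p' mult by simp
      then have "unit_in (h ` S) (h a) \<or> unit_in (h ` S) (h b)"
        using p ab unfolding irreducible_in_def by blast
      then show "unit_in S a \<or> unit_in S b" using unit ab by simp
    qed
    then have "prime_in S p'" by (rule irreducible_imp_prime_in)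
    then show "prime_in (h ` S) p"
      unfolding prime_in_def using p' dvd mult_in by (auto simp flip: mult)
  qed
qed

lemma sum_single_lookup:
  "(\<Sum>m\<in>Poly_Mapping.keys p. Poly_Mapping.single m (Poly_Mapping.lookup p m)) = p"
  by (rule poly_mapping_eqI)
     (simp add: lookup_sum lookup_single when_def in_keys_iff)

text \<open>Identities that are additive in a polynomial, in an element of the free algebra or in both arguments
of a product need to be checked on single terms only.\<close>

lemma poly_mapping_additive_induct [case_names zero single add]:
  fixes p :: "'a \<Rightarrow>\<^sub>0 'b::comm_monoid_add"
  assumes zero: "Q 0"
    and single: "\<And>m. m \<in> Poly_Mapping.keys p \<Longrightarrow> Q (Poly_Mapping.single m (Poly_Mapping.lookup p m))"
    and add: "\<And>a b. Q a \<Longrightarrow> Q b \<Longrightarrow> Q (a + b)"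
  shows "Q p"
proof -
  have "Q (\<Sum>m\<in>M. Poly_Mapping.single m (Poly_Mapping.lookup p m))"
    if "finite M" "M \<subseteq> Poly_Mapping.keys p" for M
    using that by (induction M rule: finite_induct) (auto intro: zero add single)
  from this[of "Poly_Mapping.keys p"] show ?thesis by (simp add: sum_single_lookup)
qed

definition polys_on :: "'v set \<Rightarrow> (('v \<Rightarrow>\<^sub>0 nat) \<Rightarrow>\<^sub>0 'k::field) set" where
  "polys_on V = {p. \<forall>m\<in>Poly_Mapping.keys p. Poly_Mapping.keys m \<subseteq> V}"

lemma polys_on_mono: "V \<subseteq> W \<Longrightarrow> p \<in> polys_on V \<Longrightarrow> p \<in> polys_on W"
  by (auto simp: polys_on_def)

lemma polys_on_single:
  "Poly_Mapping.keys m \<subseteq> V \<Longrightarrow> Poly_Mapping.single m c \<in> polys_on V"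
  by (auto simp: polys_on_def)

lemma sub_idom_polys_on:
  "sub_idom (polys_on V :: (('v::linorder \<Rightarrow>\<^sub>0 nat) \<Rightarrow>\<^sub>0 'k::field) set)"
proof
  show "a + b \<in> polys_on V" if "a \<in> polys_on V" "b \<in> polys_on V"
    for a b :: "('v \<Rightarrow>\<^sub>0 nat) \<Rightarrow>\<^sub>0 'k"
    using that Poly_Mapping.keys_add[of a b] by (auto simp: polys_on_def)
  show "a * b \<in> polys_on V" if "a \<in> polys_on V" "b \<in> polys_on V"
    for a b :: "('v \<Rightarrow>\<^sub>0 nat) \<Rightarrow>\<^sub>0 'k"
    unfolding polys_on_def
  proof (intro CollectI ballI)
    fix m assume "m \<in> Poly_Mapping.keys (a * b)"
    then obtain m1 m2 where m: "m1 \<in> Poly_Mapping.keys a" "m2 \<in> Poly_Mapping.keys b" "m = m1 + m2"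
      using Poly_Mapping.keys_mult[of a b] by blast
    then have "Poly_Mapping.keys m1 \<subseteq> V" "Poly_Mapping.keys m2 \<subseteq> V"
      using that by (auto simp: polys_on_def)
    then show "Poly_Mapping.keys m \<subseteq> V" using Poly_Mapping.keys_add[of m1 m2] m(3) by blast
  qed
qed (auto simp: polys_on_def)

lemma factorial_constants:
  "factorial_sub_idom (polys_on {} :: (('v::linorder \<Rightarrow>\<^sub>0 nat) \<Rightarrow>\<^sub>0 'k::field) set)"
proof -
  let ?K = "polys_on {} :: (('v \<Rightarrow>\<^sub>0 nat) \<Rightarrow>\<^sub>0 'k) set"
  interpret sub_idom ?K by (rule sub_idom_polys_on)
  have unit: "unit_in ?K a" if "a \<in> ?K" "a \<noteq> 0" for a
  proof -
    have "Poly_Mapping.keys a \<subseteq> {0}" using that by (auto simp: polys_on_def)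
    then have a: "a = Poly_Mapping.single 0 (Poly_Mapping.lookup a 0)"
      by (intro poly_mapping_eqI) (auto simp: lookup_single when_def in_keys_iff subset_iff)
    then have nz: "Poly_Mapping.lookup a 0 \<noteq> 0" using that by auto
    let ?b = "Poly_Mapping.single 0 (inverse (Poly_Mapping.lookup a 0)) :: ('v \<Rightarrow>\<^sub>0 nat) \<Rightarrow>\<^sub>0 'k"
    have "a * ?b = 1" using nz by (subst a) (simp add: mult_single)
    moreover have "?b \<in> ?K" by (rule polys_on_single) simp
    ultimately show ?thesis using that unfolding unit_in_def by blast
  qed
  show ?thesis
  proof
    show "\<exists>\<delta>::(('v \<Rightarrow>\<^sub>0 nat) \<Rightarrow>\<^sub>0 'k) \<Rightarrow> nat.
        (\<forall>a\<in>?K. \<forall>b\<in>?K. a \<noteq> 0 \<longrightarrow> b \<noteq> 0 \<longrightarrow> \<delta> (a * b) = \<delta> a + \<delta> b) \<and>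
        (\<forall>a\<in>?K. a \<noteq> 0 \<longrightarrow> \<delta> a = 0 \<longrightarrow> unit_in ?K a)"
      using unit by (intro exI[of _ "\<lambda>_. 0"]) auto
    show "prime_in ?K p" if "irreducible_in ?K p" for p
      using that unit by (auto simp: irreducible_in_def)
  qed
qed

definition indeterminate :: "'v \<Rightarrow> ('v \<Rightarrow>\<^sub>0 nat) \<Rightarrow>\<^sub>0 'k::field" where
  "indeterminate v = Poly_Mapping.single (Poly_Mapping.single v 1) 1"

lemma indeterminate_power:
  "(indeterminate v :: ('v \<Rightarrow>\<^sub>0 nat) \<Rightarrow>\<^sub>0 'k::field) ^ i =
     Poly_Mapping.single (Poly_Mapping.single v i) 1"
proof (induction i)
  case (Suc i)
  have "(indeterminate v :: ('v \<Rightarrow>\<^sub>0 nat) \<Rightarrow>\<^sub>0 'k) ^ Suc i =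
      Poly_Mapping.single (Poly_Mapping.single v 1 + Poly_Mapping.single v i) 1"
    unfolding power_Suc Suc by (simp add: mult_single indeterminate_def)
  also have "Poly_Mapping.single v 1 + Poly_Mapping.single v i = Poly_Mapping.single v (Suc i)"
    unfolding single_add[symmetric] by simp
  finally show ?case .
qed simp

text \<open>\<open>k[V \<union> {v}]\<close> is the image of \<open>k[V][X]\<close> under evaluation at \<open>v\<close>: a
monomial is a monomial in \<open>V\<close> times a power of \<open>v\<close>.\<close>

lemma polys_on_insert:
  fixes V :: "'v::linorder set"
  shows "polys_on (insert v V) =
    (\<lambda>p. poly p (indeterminate v)) ` polys_in (polys_on V :: (('v \<Rightarrow>\<^sub>0 nat) \<Rightarrow>\<^sub>0 'k::field) set)"
    (is "?L = ?h ` ?T")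
proof -
  let ?S = "polys_on V :: (('v \<Rightarrow>\<^sub>0 nat) \<Rightarrow>\<^sub>0 'k) set"
  interpret S: sub_idom ?S by (rule sub_idom_polys_on)
  interpret T: sub_idom ?T by (rule S.sub_idom_polys_in)
  interpret L: sub_idom "?L :: (('v \<Rightarrow>\<^sub>0 nat) \<Rightarrow>\<^sub>0 'k) set" by (rule sub_idom_polys_on)
  have "?h p \<in> ?L" if "p \<in> ?T" for p
    unfolding poly_altdef
  proof (rule L.sum_in, rule L.mult_in)
    fix i
    have "coeff p i \<in> ?S" using that unfolding polys_in_def by blast
    then show "coeff p i \<in> ?L" by (rule polys_on_mono[rotated]) blast
    show "indeterminate v ^ i \<in> ?L"
      unfolding indeterminate_power by (rule polys_on_single) simp
  qed
  moreover have "p \<in> ?h ` ?T" if "p \<in> ?L" for p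
  proof (induction p rule: poly_mapping_additive_induct)
    case zero
    show ?case by (intro image_eqI[of _ _ 0]) auto
  next
    case (single m)
    define i m' where "i = Poly_Mapping.lookup m v" and "m' = m - Poly_Mapping.single v i"
    have m: "m = m' + Poly_Mapping.single v i"
      by (rule poly_mapping_eqI) (auto simp: m'_def i_def lookup_add lookup_minus lookup_single when_def)
    have "Poly_Mapping.keys m \<subseteq> insert v V" using single that by (auto simp: polys_on_def)
    then have "Poly_Mapping.keys m' \<subseteq> V"
      by (auto simp: m'_def i_def in_keys_iff lookup_minus lookup_single when_def subset_iff split: if_splits)
    then have "monom (Poly_Mapping.single m' (Poly_Mapping.lookup p m)) i \<in> ?T"
      by (intro S.polys_in_monom polys_on_single)
    moreover have "Poly_Mapping.single m (Poly_Mapping.lookup p m) =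
        ?h (monom (Poly_Mapping.single m' (Poly_Mapping.lookup p m)) i)"
      by (simp add: poly_monom indeterminate_power mult_single flip: m)
    ultimately show ?case by blast
  next
    case (add a b)
    then show ?case using T.add_in by (auto simp flip: poly_add)
  qed
  ultimately show ?thesis by blast
qed

text \<open>The evaluation is injective: no monomial of the constant coefficient contains \<open>v\<close>, whereas
every monomial of the remaining terms does, so both parts of a vanishing sum vanish.\<close>

lemma poly_indeterminate_eq_0:
  fixes V :: "'v::linorder set" and p :: "(('v \<Rightarrow>\<^sub>0 nat) \<Rightarrow>\<^sub>0 'k::field) poly"
  assumes "v \<notin> V" "p \<in> polys_in (polys_on V)" "poly p (indeterminate v) = 0"
  shows "p = 0"
  using assms(2,3)
proof (induction p)
  case (pCons a p)
  let ?X = "indeterminate v :: ('v \<Rightarrow>\<^sub>0 nat) \<Rightarrow>\<^sub>0 'k"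
  have coeffs: "coeff (pCons a p) i \<in> polys_on V" for i
    using pCons.prems(1) unfolding polys_in_def by blast
  have a: "a \<in> polys_on V" using coeffs[of 0] by simp
  have "coeff p i \<in> polys_on V" for i using coeffs[of "Suc i"] by simp
  then have p: "p \<in> polys_in (polys_on V)" unfolding polys_in_def by blast
  have eq: "?X * poly p ?X = - a"
    using pCons.prems(2) by (simp add: add_eq_0_iff2)
  have "a = 0"
  proof (rule ccontr)
    assume "a \<noteq> 0"
    then obtain m where m: "m \<in> Poly_Mapping.keys a" by fastforce
    then have "m \<in> Poly_Mapping.keys (?X * poly p ?X)" unfolding eq by simp
    then obtain m' where "m = Poly_Mapping.single v 1 + m'"
      using Poly_Mapping.keys_mult[of ?X] by (fastforce simp: indeterminate_def)
    then have "v \<in> Poly_Mapping.keys m" by (simp add: in_keys_iff lookup_add)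
    with a m assms(1) show False by (auto simp: polys_on_def)
  qed
  moreover have "Poly_Mapping.lookup ?X (Poly_Mapping.single v 1) \<noteq> 0" by (simp add: indeterminate_def)
  then have "?X \<noteq> 0" by auto
  ultimately have "poly p ?X = 0" using eq by simp
  with pCons.IH p \<open>a = 0\<close> show ?case by simp
qed simp

theorem factorial_polys_on:
  fixes V :: "'v::linorder set"
  assumes "finite V"
  shows "factorial_sub_idom (polys_on V :: (('v \<Rightarrow>\<^sub>0 nat) \<Rightarrow>\<^sub>0 'k::field) set)"
  using assms
proof (induction V rule: finite_induct)
  case empty
  show ?case by (rule factorial_constants)
next
  case (insert v V)
  interpret S: factorial_sub_idom "polys_on V :: (('v \<Rightarrow>\<^sub>0 nat) \<Rightarrow>\<^sub>0 'k) set"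
    by (rule insert.IH)
  interpret T: factorial_sub_idom "polys_in (polys_on V :: (('v \<Rightarrow>\<^sub>0 nat) \<Rightarrow>\<^sub>0 'k) set)"
    by (rule S.factorial_polys_in)
  show ?case
    unfolding polys_on_insert
    using insert.hyps
    by (intro T.factorial_image poly_indeterminate_eq_0) auto
qed

text \<open>A linear order of the indeterminates induces one of the monomials. Leading monomials then show that
the polynomials form an integral domain.\<close>

instantiation indet :: linorder
begin

fun indet_code :: "indet \<Rightarrow> nat" where
  "indet_code (XVar i) = 2 * i"
| "indet_code (YVar i) = 2 * i + 1"

definition less_eq_indet :: "indet \<Rightarrow> indet \<Rightarrow> bool" where
  "u \<le> v \<longleftrightarrow> indet_code u \<le> indet_code v"

definition less_indet :: "indet \<Rightarrow> indet \<Rightarrow> bool" where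
  "u < v \<longleftrightarrow> indet_code u < indet_code v"

instance
proof
  show "u = v" if "u \<le> v" "v \<le> u" for u v :: indet
    using that unfolding less_eq_indet_def by (cases u; cases v) (auto, presburger+)
qed (auto simp: less_eq_indet_def less_indet_def)

end

lemma carrier_poly_alg: "carrier (poly_alg n) = polys_on (indets n)"
  by (simp add: poly_alg_def polys_on_def)

lemma finite_indets: "finite (indets n)"
  by (simp add: indets_def)

lemma Units_poly_alg: "Units (poly_alg n) = {u. unit_in (polys_on (indets n)) u}"
  unfolding Units_def unit_in_def carrier_poly_alg
  by (auto simp: poly_alg_def mult.commute)

text \<open>The irreducibility of \<open>f\<close> is given through proper factors: a factor \<open>a\<close> of
\<open>p = a * b\<close> that is not proper is a multiple of \<open>p\<close>, and then \<open>b\<close> is a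
unit.\<close>

lemma irreducible_in_if_ring_irreducible:
  fixes p :: "(indet \<Rightarrow>\<^sub>0 nat) \<Rightarrow>\<^sub>0 'k::field"
  assumes p: "p \<in> polys_on (indets n)" and irr: "ring_irreducible\<^bsub>poly_alg n\<^esub> p"
  shows "irreducible_in (polys_on (indets n)) p"
  unfolding irreducible_in_def
proof (intro conjI ballI impI)
  have ops: "mult (poly_alg n) = ((*) :: ((indet \<Rightarrow>\<^sub>0 nat) \<Rightarrow>\<^sub>0 'k) \<Rightarrow> _)"
    "zero (poly_alg n) = (0 :: (indet \<Rightarrow>\<^sub>0 nat) \<Rightarrow>\<^sub>0 'k)"
    by (simp_all add: poly_alg_def)
  show p0: "p \<noteq> 0" and "\<not> unit_in (polys_on (indets n)) p"
    using irr by (auto simp: ring_irreducible_def Divisibility.irreducible_def Units_poly_alg ops)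
  fix a b assume ab: "a \<in> polys_on (indets n)" "b \<in> polys_on (indets n)" "p = a * b"
  show "unit_in (polys_on (indets n)) a \<or> unit_in (polys_on (indets n)) b"
  proof (cases "properfactor (poly_alg n) a p")
    case True
    then show ?thesis
      using irr ab by (auto simp: ring_irreducible_def Divisibility.irreducible_def Units_poly_alg carrier_poly_alg)
  next
    case False
    have "a divides\<^bsub>poly_alg n\<^esub> p"
      using ab by (auto simp: factor_def carrier_poly_alg ops)
    with False have "p divides\<^bsub>poly_alg n\<^esub> a" by (simp add: properfactor_def)
    then obtain c where c: "c \<in> polys_on (indets n)" "a = p * c"
      by (auto simp: factor_def carrier_poly_alg ops)
    then have "a * (b * c) = a * 1" using ab by (simp add: mult.assoc)
    moreover have "a \<noteq> 0" using p0 ab by auto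
    ultimately have "b * c = 1" by (metis mult_left_cancel)
    then show ?thesis using ab(2) c(1) unfolding unit_in_def by blast
  qed
qed (rule p)

section \<open>Twisted products\<close>

text \<open>The bilinear product that multiplies monomials up to a scalar, \<open>m \<star> m' = w m m' (m + m')\<close>,
exponents being written additively.\<close>

definition twisted_mult ::
    "('m::monoid_add \<Rightarrow> 'm \<Rightarrow> 'k::comm_ring_1) \<Rightarrow> ('m \<Rightarrow>\<^sub>0 'k) \<Rightarrow> ('m \<Rightarrow>\<^sub>0 'k) \<Rightarrow> ('m \<Rightarrow>\<^sub>0 'k)" where
  "twisted_mult w p r =
     (\<Sum>m\<in>Poly_Mapping.keys p. \<Sum>m'\<in>Poly_Mapping.keys r.
        Poly_Mapping.single (m + m') (w m m' * (Poly_Mapping.lookup p m * Poly_Mapping.lookup r m')))"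

lemma twisted_mult_add_left: "twisted_mult w (p + p') r = twisted_mult w p r + twisted_mult w p' r"
  unfolding twisted_mult_def
  by (rule setsum_keys_plus_distrib)
     (simp_all add: distrib_left distrib_right single_add sum.distrib)

lemma twisted_mult_add_right: "twisted_mult w p (r + r') = twisted_mult w p r + twisted_mult w p r'"
  unfolding twisted_mult_def sum.distrib[symmetric]
  by (rule sum.cong[OF refl], rule setsum_keys_plus_distrib)
     (simp_all add: distrib_left single_add)

lemma twisted_mult_single:
  "twisted_mult w (Poly_Mapping.single m c) (Poly_Mapping.single m' c') =
     Poly_Mapping.single (m + m') (w m m' * (c * c'))"
  by (simp add: twisted_mult_def)

lemma twisted_mult_zero [simp]: "twisted_mult w 0 r = 0" "twisted_mult w p 0 = 0"
  by (simp_all add: twisted_mult_def)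

lemma keys_twisted_mult:
  "Poly_Mapping.keys (twisted_mult w p r) \<subseteq>
     {m + m' | m m'. m \<in> Poly_Mapping.keys p \<and> m' \<in> Poly_Mapping.keys r}"
proof -
  have "Poly_Mapping.keys (twisted_mult w p r) \<subseteq>
      (\<Union>m\<in>Poly_Mapping.keys p. \<Union>m'\<in>Poly_Mapping.keys r. {m + m'})"
    unfolding twisted_mult_def
    by (intro order_trans[OF keys_sum] UN_mono order_refl) simp
  then show ?thesis by blast
qed

text \<open>Moving the \<open>y\<close>-part of \<open>m\<close> past the \<open>x\<close>-part of \<open>m'\<close> costs one
factor \<open>q\<close> for each pair of letters.\<close>

definition q_twist :: "'k::field \<Rightarrow> nat \<Rightarrow> (indet \<Rightarrow>\<^sub>0 nat) \<Rightarrow> (indet \<Rightarrow>\<^sub>0 nat) \<Rightarrow> 'k" where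
  "q_twist q n m m' = q ^ (snd (bidegree n m) * fst (bidegree n m'))"

lemma bidegree_zero [simp]: "bidegree n 0 = (0, 0)"
  by (simp add: bidegree_def)

lemma bidegree_add: "bidegree n (m + m') =
    (fst (bidegree n m) + fst (bidegree n m'), snd (bidegree n m) + snd (bidegree n m'))"
  by (simp add: bidegree_def lookup_add sum.distrib)

section \<open>Normal forms of words\<close>

definition word_monomial :: "indet list \<Rightarrow> (indet \<Rightarrow>\<^sub>0 nat)" where
  "word_monomial ls = sum_list (map (\<lambda>l. Poly_Mapping.single l 1) ls)"

lemma word_monomial_simps [simp]:
  "word_monomial [] = 0"
  "word_monomial (l # ls) = Poly_Mapping.single l 1 + word_monomial ls"
  "word_monomial (us @ vs) = word_monomial us + word_monomial vs"
  by (simp_all add: word_monomial_def)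

lemma lookup_word_monomial: "Poly_Mapping.lookup (word_monomial ls) v = count_list ls v"
  by (induction ls) (auto simp: lookup_add lookup_single when_def)

text \<open>The number of pairs of letters of a word in which a \<open>y\<close> precedes an \<open>x\<close>, among the
indeterminates up to order \<open>n\<close>: the exponent of \<open>q\<close> that sorting the word produces.\<close>

fun inversions :: "nat \<Rightarrow> indet list \<Rightarrow> nat" where
  "inversions n [] = 0"
| "inversions n (l # ls) =
     snd (bidegree n (Poly_Mapping.single l 1)) * fst (bidegree n (word_monomial ls)) + inversions n ls"

lemma inversions_append:
  "inversions n (us @ vs) = inversions n us + inversions n vs +
     snd (bidegree n (word_monomial us)) * fst (bidegree n (word_monomial vs))"
  by (induction us) (simp_all add: bidegree_add algebra_simps)

text \<open>The linear map that sorts each word. It is a ring homomorphism from the free algebra to the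
polynomials with the twisted product, and it will turn out to be inverse to \<open>to_q_alg\<close> on
classes.\<close>

definition normal_form :: "'k::field \<Rightarrow> nat \<Rightarrow> (indet free_monoid \<Rightarrow>\<^sub>0 'k) \<Rightarrow> ((indet \<Rightarrow>\<^sub>0 nat) \<Rightarrow>\<^sub>0 'k)" where
  "normal_form q n a =
     (\<Sum>w\<in>Poly_Mapping.keys a. Poly_Mapping.single (word_monomial (letters w))
        (q ^ inversions n (letters w) * Poly_Mapping.lookup a w))"

lemma normal_form_add: "normal_form q n (a + b) = normal_form q n a + normal_form q n b"
  unfolding normal_form_def by (rule setsum_keys_plus_distrib) (simp_all add: distrib_left single_add)

lemma normal_form_zero [simp]: "normal_form q n 0 = 0"
  by (simp add: normal_form_def)

lemma normal_form_uminus: "normal_form q n (- a) = - normal_form q n a"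
  using normal_form_add[of q n a "- a"] by (simp add: eq_neg_iff_add_eq_0 add.commute)

lemma normal_form_diff: "normal_form q n (a - b) = normal_form q n a - normal_form q n b"
  using normal_form_add[of q n a "- b"] by (simp add: normal_form_uminus)

lemma normal_form_single:
  "normal_form q n (Poly_Mapping.single w c) =
     Poly_Mapping.single (word_monomial (letters w)) (q ^ inversions n (letters w) * c)"
  by (simp add: normal_form_def)

lemma normal_form_mult:
  "normal_form q n (a * b) = twisted_mult (q_twist q n) (normal_form q n a) (normal_form q n b)"
proof (induction a rule: poly_mapping_additive_induct)
  case (single u)
  show ?case
  proof (induction b rule: poly_mapping_additive_induct)
    case (single v)
    show ?case
      by (simp add: mult_single normal_form_single twisted_mult_single inversions_append q_twist_def
          power_add mult_ac)
  qed (simp_all add: distrib_left normal_form_add twisted_mult_add_right)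
qed (simp_all add: distrib_right normal_form_add twisted_mult_add_left)

lemma keys_word_monomial: "Poly_Mapping.keys (word_monomial ls) = set ls"
  by (auto simp: in_keys_iff lookup_word_monomial count_list_0_iff)

lemma normal_form_in_polys_on:
  "a \<in> carrier (free_alg n) \<Longrightarrow> normal_form q n a \<in> polys_on (indets n)"
proof -
  assume "a \<in> carrier (free_alg n)"
  then have "\<forall>w\<in>Poly_Mapping.keys a. set (letters w) \<subseteq> indets n" by (simp add: free_alg_def)
  then have "Poly_Mapping.keys m \<subseteq> indets n" if "m \<in> Poly_Mapping.keys (normal_form q n a)" for m
    using that keys_sum unfolding normal_form_def
    by (fastforce simp: keys_word_monomial split: if_splits dest!: subsetD[OF keys_sum])
  then show ?thesis by (simp add: polys_on_def)
qed

lemma bidegree_X [simp]: "snd (bidegree n (Poly_Mapping.single (XVar i) k)) = 0"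
  and bidegree_Y [simp]: "fst (bidegree n (Poly_Mapping.single (YVar i) k)) = 0"
  by (simp_all add: bidegree_def lookup_single)

lemma bidegree_word_X: "set ls \<subseteq> range XVar \<Longrightarrow> snd (bidegree n (word_monomial ls)) = 0"
  by (induction ls) (auto simp: bidegree_add)

lemma bidegree_word_Y: "set ls \<subseteq> range YVar \<Longrightarrow> fst (bidegree n (word_monomial ls)) = 0"
  by (induction ls) (auto simp: bidegree_add)

lemma inversions_X: "set ls \<subseteq> range XVar \<Longrightarrow> inversions n ls = 0"
  by (induction ls) auto

lemma inversions_Y: "set ls \<subseteq> range YVar \<Longrightarrow> inversions n ls = 0"
  by (induction ls) (auto simp: bidegree_word_Y)

text \<open>The part of an ordered word on one family of indeterminates, \<open>f\<close> being \<open>XVar\<close> or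
\<open>YVar\<close>.\<close>

definition blocks :: "nat \<Rightarrow> (nat \<Rightarrow> indet) \<Rightarrow> (indet \<Rightarrow>\<^sub>0 nat) \<Rightarrow> indet list" where
  "blocks n f m = concat (map (\<lambda>i. replicate (Poly_Mapping.lookup m (f i)) (f i)) [0..<Suc n])"

lemma letters_ordered_word: "letters (ordered_word n m) = blocks n XVar m @ blocks n YVar m"
  by (simp add: ordered_word_def blocks_def)

lemma set_blocks: "set (blocks n f m) \<subseteq> f ` {..n}"
  by (auto simp: blocks_def)

lemma count_blocks:
  assumes "inj f"
  shows "count_list (blocks n f m) v = (if v \<in> f ` {..n} then Poly_Mapping.lookup m v else 0)"
proof (cases "v \<in> f ` {..n}")
  case True
  then obtain j where j: "j \<le> n" "v = f j" by auto
  have count_rep: "count_list (replicate k x) y = (if x = y then k else 0)" for k and x y :: indet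
    by (induction k) auto
  have "count_list (concat (map (\<lambda>i. replicate (Poly_Mapping.lookup m (f i)) (f i)) js)) v =
      (\<Sum>i\<leftarrow>js. if i = j then Poly_Mapping.lookup m v else 0)" for js
    using assms j by (induction js) (auto simp: count_rep inj_eq)
  then have "count_list (blocks n f m) v = (\<Sum>i\<leftarrow>[0..<Suc n]. if i = j then Poly_Mapping.lookup m v else 0)"
    unfolding blocks_def by blast
  also have "\<dots> = Poly_Mapping.lookup m v"
    using j by (subst sum_list_distinct_conv_sum_set) (auto simp del: upt_Suc)
  finally show ?thesis using True by simp
next
  case False
  then have "v \<notin> set (blocks n f m)" using set_blocks by blast
  then show ?thesis using False by (simp add: count_list_0_iff)
qed

lemma word_monomial_ordered_word:
  assumes "Poly_Mapping.keys m \<subseteq> indets n"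
  shows "word_monomial (letters (ordered_word n m)) = m"
proof (rule poly_mapping_eqI)
  fix v
  have "inj XVar" "inj YVar" by (auto intro: injI)
  note c = count_blocks[OF this(1)] count_blocks[OF this(2)]
  have "v \<notin> XVar ` {..n} \<Longrightarrow> v \<notin> YVar ` {..n} \<Longrightarrow> Poly_Mapping.lookup m v = 0"
    using assms by (auto simp: indets_def in_keys_iff)
  moreover have "\<not> (v \<in> XVar ` {..n} \<and> v \<in> YVar ` {..n})" by auto
  ultimately show "Poly_Mapping.lookup (word_monomial (letters (ordered_word n m))) v = Poly_Mapping.lookup m v"
    unfolding lookup_word_monomial letters_ordered_word count_list_append c by auto
qed

lemma inversions_ordered_word: "inversions n (letters (ordered_word n m)) = 0"
proof -
  have "set (blocks n XVar m) \<subseteq> range XVar" "set (blocks n YVar m) \<subseteq> range YVar"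
    using set_blocks by fastforce+
  then show ?thesis
    unfolding letters_ordered_word inversions_append
    by (simp add: inversions_X inversions_Y bidegree_word_X)
qed

lemma blocks_insert:
  assumes "inj f" "i \<le> n"
  shows "\<exists>us vs. blocks n f m = us @ vs \<and> blocks n f (m + Poly_Mapping.single (f i) 1) = us @ f i # vs"
proof -
  let ?r = "\<lambda>m i. replicate (Poly_Mapping.lookup m (f i)) (f i)"
  let ?m = "m + Poly_Mapping.single (f i) 1"
  have split: "[0..<Suc n] = [0..<i] @ i # [Suc i..<Suc n]"
    using assms(2) upt_add_eq_append[of 0 i "Suc n - i"] upt_conv_Cons[of i "Suc n"] by simp
  have other: "Poly_Mapping.lookup ?m (f j) = Poly_Mapping.lookup m (f j)" if "j \<noteq> i" for j
    using that assms(1) by (simp add: lookup_add lookup_single inj_eq)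
  have "map (?r ?m) [0..<i] = map (?r m) [0..<i]" "map (?r ?m) [Suc i..<Suc n] = map (?r m) [Suc i..<Suc n]"
    by (auto simp: other simp del: upt_Suc One_nat_def)
  moreover have "?r ?m i = f i # ?r m i" by (simp add: lookup_add)
  ultimately have "blocks n f ?m = concat (map (?r m) [0..<i]) @ f i # (?r m i @ concat (map (?r m) [Suc i..<Suc n]))"
    unfolding blocks_def split by (simp only: map_append list.map concat_append concat.simps append_Cons)
  moreover have "blocks n f m = concat (map (?r m) [0..<i]) @ (?r m i @ concat (map (?r m) [Suc i..<Suc n]))"
    unfolding blocks_def split by simp
  ultimately show ?thesis by blast
qed

lemma blocks_unaffected:
  "l \<notin> range f \<Longrightarrow> blocks n f (m + Poly_Mapping.single l 1) = blocks n f m"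
proof -
  assume "l \<notin> range f"
  then have "Poly_Mapping.lookup (m + Poly_Mapping.single l 1) (f i) = Poly_Mapping.lookup m (f i)" for i
    by (auto simp: lookup_add lookup_single when_def)
  then show ?thesis by (simp add: blocks_def)
qed

text \<open>Raising one exponent inserts one letter into the ordered word. In front of an inserted \<open>x\<close>
stand only \<open>x\<close>'s, so a letter that enters from the left reaches its place by commutations and by
rewriting \<open>y x\<close> to \<open>q x y\<close>, never the other way round.\<close>

lemma ordered_word_insert:
  assumes "l \<in> indets n"
  shows "\<exists>us vs. letters (ordered_word n m) = us @ vs \<and>
    letters (ordered_word n (m + Poly_Mapping.single l 1)) = us @ l # vs \<and>
    set us \<subseteq> indets n \<and> (l \<in> range XVar \<longrightarrow> set us \<subseteq> range XVar)"
proof (cases l)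
  case (XVar i)
  have "inj XVar" by (auto intro: injI)
  then obtain us vs where uv: "blocks n XVar m = us @ vs"
    "blocks n XVar (m + Poly_Mapping.single l 1) = us @ l # vs"
    using blocks_insert[of XVar i n m] assms XVar by (auto simp: indets_def)
  moreover have "blocks n YVar (m + Poly_Mapping.single l 1) = blocks n YVar m"
    using XVar by (intro blocks_unaffected) auto
  moreover have "set us \<subseteq> XVar ` {..n}" using set_blocks[of n XVar m] uv by auto
  ultimately show ?thesis
    unfolding letters_ordered_word
    by (intro exI[of _ us] exI[of _ "vs @ blocks n YVar m"]) (auto simp: indets_def)
next
  case (YVar i)
  have "inj YVar" by (auto intro: injI)
  then obtain us vs where uv: "blocks n YVar m = us @ vs"
    "blocks n YVar (m + Poly_Mapping.single l 1) = us @ l # vs"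
    using blocks_insert[of YVar i n m] assms YVar by (auto simp: indets_def)
  moreover have "blocks n XVar (m + Poly_Mapping.single l 1) = blocks n XVar m"
    using YVar by (intro blocks_unaffected) auto
  moreover have "set us \<subseteq> YVar ` {..n}" using set_blocks[of n YVar m] uv by auto
  moreover have "set (blocks n XVar m) \<subseteq> XVar ` {..n}" by (rule set_blocks)
  ultimately show ?thesis
    unfolding letters_ordered_word
    by (intro exI[of _ "blocks n XVar m @ us"] exI[of _ vs]) (auto simp: indets_def YVar)
qed

section \<open>The quotient algebra as a twisted polynomial ring\<close>

lemma free_alg_simps [simp]:
  "mult (free_alg n) = (*)" "add (free_alg n) = (+)" "one (free_alg n) = 1" "zero (free_alg n) = 0"
  by (simp_all add: free_alg_def)

text \<open>Closure under negatives comes from multiplication by \<open>-1\<close>.\<close>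

lemma ideal_if_closed:
  fixes R (structure)
  assumes "ring R" and sub: "I \<subseteq> carrier R" and zero: "\<zero> \<in> I"
    and add: "\<And>a b. a \<in> I \<Longrightarrow> b \<in> I \<Longrightarrow> a \<oplus> b \<in> I"
    and left: "\<And>a x. a \<in> I \<Longrightarrow> x \<in> carrier R \<Longrightarrow> x \<otimes> a \<in> I"
    and right: "\<And>a x. a \<in> I \<Longrightarrow> x \<in> carrier R \<Longrightarrow> a \<otimes> x \<in> I"
  shows "ideal I R"
proof (rule idealI[OF \<open>ring R\<close> _ left right])
  interpret ring R by fact
  show "subgroup I (add_monoid R)"
  proof (rule add.subgroupI)
    show "I \<subseteq> carrier R" "I \<noteq> {}" using sub zero by auto
    show "\<ominus> a \<in> I" if "a \<in> I" for a
    proof -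
      have "\<ominus> a = (\<ominus> \<one>) \<otimes> a" using that sub by (auto simp: l_minus)
      then show ?thesis using left that by simp
    qed
  qed (use add in auto)
qed

lemma ordered_rep_add: "ordered_rep n (p + p') = ordered_rep n p + ordered_rep n p'"
  unfolding ordered_rep_def by (rule setsum_keys_plus_distrib) (simp_all add: single_add)

lemma ordered_rep_zero [simp]: "ordered_rep n 0 = 0"
  by (simp add: ordered_rep_def)

lemma ordered_rep_single:
  "ordered_rep n (Poly_Mapping.single m c) = Poly_Mapping.single (ordered_word n m) c"
  by (simp add: ordered_rep_def)

lemma single_in_free_alg:
  "set (letters w) \<subseteq> indets n \<Longrightarrow> Poly_Mapping.single w c \<in> carrier (free_alg n)"
  by (simp add: free_alg_def)

lemma free_alg_add: "a \<in> carrier (free_alg n) \<Longrightarrow> b \<in> carrier (free_alg n) \<Longrightarrow> a + b \<in> carrier (free_alg n)"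
  using ring.ring_simprules(1)[OF ring_free_alg, of a n b] by simp

lemma free_alg_mult: "a \<in> carrier (free_alg n) \<Longrightarrow> b \<in> carrier (free_alg n) \<Longrightarrow> a * b \<in> carrier (free_alg n)"
  using ring.ring_simprules(5)[OF ring_free_alg, of a n b] by simp

lemma ordered_rep_in_free_alg: "ordered_rep n p \<in> carrier (free_alg n)"
proof (induction p rule: poly_mapping_additive_induct)
  case zero
  show ?case by (simp add: free_alg_def)
next
  case (single m)
  have "set (letters (ordered_word n m)) \<subseteq> indets n"
    using set_blocks[of n XVar m] set_blocks[of n YVar m]
    by (auto simp: letters_ordered_word indets_def)
  then show ?case unfolding ordered_rep_single by (rule single_in_free_alg)
next
  case (add a b)
  then show ?case unfolding ordered_rep_add by (rule free_alg_add)
qed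

lemma normal_form_ordered_rep:
  assumes "p \<in> polys_on (indets n)"
  shows "normal_form q n (ordered_rep n p) = p"
proof (induction p rule: poly_mapping_additive_induct)
  case (single m)
  then have "Poly_Mapping.keys m \<subseteq> indets n" using assms by (auto simp: polys_on_def)
  then show ?case
    by (simp add: ordered_rep_single normal_form_single word_monomial_ordered_word inversions_ordered_word)
qed (simp_all add: ordered_rep_add normal_form_add)

lemma q_relations_normal_form: "r \<in> q_relations q n \<Longrightarrow> normal_form q n r = 0"
  unfolding q_relations_def
  by (auto simp: gen_def scalar_def mult_single plus_free_monoid_def zero_free_monoid_def
      normal_form_diff normal_form_single add.commute bidegree_def lookup_single when_def)

text \<open>Since \<open>normal_form\<close> is multiplicative for the twisted product, its kernel is a two-sided ideal,
and sorting both sides of a defining relation gives the same polynomial.\<close>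

lemma q_ideal_subset_kernel:
  "q_ideal q n \<subseteq> {a \<in> carrier (free_alg n). normal_form q n a = 0}" (is "_ \<subseteq> ?K")
proof -
  interpret ring "free_alg n :: (indet free_monoid \<Rightarrow>\<^sub>0 'a) ring" by (rule ring_free_alg)
  have "ideal ?K (free_alg n)"
  proof (rule ideal_if_closed[OF ring_free_alg])
    show "\<zero>\<^bsub>free_alg n\<^esub> \<in> ?K" using zero_closed by simp
  qed (auto simp: normal_form_add normal_form_mult intro: free_alg_add free_alg_mult)
  then show ?thesis
    unfolding q_ideal_def using q_relations_subset[of q n] q_relations_normal_form
    by (intro genideal_minimal) auto
qed

text \<open>Congruence modulo the defining relations, used to show that every class is the class of a combination
of ordered words.\<close>

definition q_cong :: "'k::field \<Rightarrow> nat \<Rightarrow> (indet free_monoid \<Rightarrow>\<^sub>0 'k) \<Rightarrow> (indet free_monoid \<Rightarrow>\<^sub>0 'k) \<Rightarrow> bool" where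
  "q_cong q n a b \<longleftrightarrow> a - b \<in> q_ideal q n"

lemma q_ideal_add: "a \<in> q_ideal q n \<Longrightarrow> b \<in> q_ideal q n \<Longrightarrow> a + b \<in> q_ideal q n"
  using additive_subgroup.a_closed[OF ideal.axioms(1)[OF ideal_q_ideal[of q n]], of a b] by simp

lemma q_cong_refl: "q_cong q n a a"
  using additive_subgroup.zero_closed[OF ideal.axioms(1)[OF ideal_q_ideal[of q n]]]
  by (simp add: q_cong_def)

lemma q_cong_trans [trans]: "q_cong q n a b \<Longrightarrow> q_cong q n b c \<Longrightarrow> q_cong q n a c"
  using q_ideal_add[of "a - b" q n "b - c"] by (simp add: q_cong_def)

lemma q_cong_add: "q_cong q n a b \<Longrightarrow> q_cong q n a' b' \<Longrightarrow> q_cong q n (a + a') (b + b')"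
  using q_ideal_add[of "a - b" q n "a' - b'"] by (simp add: q_cong_def algebra_simps)

lemma q_cong_mult_left:
  "c \<in> carrier (free_alg n) \<Longrightarrow> q_cong q n a b \<Longrightarrow> q_cong q n (c * a) (c * b)"
  using ideal.I_l_closed[OF ideal_q_ideal[of q n], of "a - b" c] by (simp add: q_cong_def right_diff_distrib)

lemma q_cong_mult_right:
  "c \<in> carrier (free_alg n) \<Longrightarrow> q_cong q n a b \<Longrightarrow> q_cong q n (a * c) (b * c)"
  using ideal.I_r_closed[OF ideal_q_ideal[of q n], of "a - b" c] by (simp add: q_cong_def left_diff_distrib)

abbreviation word :: "indet list \<Rightarrow> 'k::field \<Rightarrow> (indet free_monoid \<Rightarrow>\<^sub>0 'k)" where
  "word ls c \<equiv> Poly_Mapping.single (FM ls) c"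

lemma word_mult: "word us c * word vs d = word (us @ vs) (c * d)"
  by (simp add: mult_single plus_free_monoid_def)

lemma word_in_free_alg: "set ls \<subseteq> indets n \<Longrightarrow> word ls c \<in> carrier (free_alg n)"
  by (rule single_in_free_alg) simp

text \<open>In this lemma and the next two only the existence of the scalar is recorded: its value is forced,
because \<open>normal_form\<close> takes equal values on congruent elements.\<close>

lemma swap_letters:
  assumes "l \<in> indets n" "u \<in> indets n" "l \<in> range XVar \<longrightarrow> u \<in> range XVar"
  shows "\<exists>c. q_cong q n (word [l, u] 1) (word [u, l] c)"
proof -
  have *: "q_cong q n (word [l, u] 1) (word [u, l] c)"
    if "gen l * gen u - scalar c * (gen u * gen l) \<in> q_relations q n" for c
  proof -
    have "gen l * gen u - scalar c * (gen u * gen l) \<in> q_ideal q n"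
      unfolding q_ideal_def using ring.genideal_self[OF ring_free_alg q_relations_subset] that by blast
    then show ?thesis
      by (simp add: q_cong_def gen_def scalar_def mult_single plus_free_monoid_def zero_free_monoid_def)
  qed
  have s1: "scalar 1 = (1 :: indet free_monoid \<Rightarrow>\<^sub>0 'a)" by (simp add: scalar_def)
  consider i j where "l = XVar i" "u = XVar j" "i \<le> n" "j \<le> n"
    | i j where "l = YVar i" "u = YVar j" "i \<le> n" "j \<le> n"
    | i j where "l = YVar i" "u = XVar j" "i \<le> n" "j \<le> n"
    using assms by (auto simp: indets_def)
  then show ?thesis
  proof cases
    case 1
    then have "gen l * gen u - scalar 1 * (gen u * gen l) \<in> q_relations q n"
      unfolding q_relations_def s1 mult_1_left by blast
    from *[OF this] show ?thesis by (rule exI)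
  next
    case 2
    then have "gen l * gen u - scalar 1 * (gen u * gen l) \<in> q_relations q n"
      unfolding q_relations_def s1 mult_1_left by blast
    from *[OF this] show ?thesis by (rule exI)
  next
    case 3
    then have "gen l * gen u - scalar q * (gen u * gen l) \<in> q_relations q n"
      unfolding q_relations_def by blast
    from *[OF this] show ?thesis by (rule exI)
  qed
qed

lemma move_letter:
  assumes "l \<in> indets n" "set us \<subseteq> indets n" "l \<in> range XVar \<longrightarrow> set us \<subseteq> range XVar"
    and vs: "set vs \<subseteq> indets n"
  shows "\<exists>c. q_cong q n (word (l # us @ vs) 1) (word (us @ l # vs) c)"
  using assms(1-3)
proof (induction us)
  case Nil
  show ?case by (intro exI[of _ 1]) (simp add: q_cong_refl)
next
  case (Cons u us)
  then obtain c where c: "q_cong q n (word (l # us @ vs) 1) (word (us @ l # vs) c)" by auto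
  obtain d where d: "q_cong q n (word [l, u] 1) (word [u, l] d)"
    using swap_letters[of l n u q] Cons.prems by auto
  have "q_cong q n (word [l, u] 1 * word (us @ vs) 1) (word [u, l] d * word (us @ vs) 1)"
    using Cons.prems vs by (intro q_cong_mult_right[OF _ d] word_in_free_alg) auto
  moreover have "q_cong q n (word [u] d * word (l # us @ vs) 1) (word [u] d * word (us @ l # vs) c)"
    using Cons.prems by (intro q_cong_mult_left[OF _ c] word_in_free_alg) auto
  ultimately have "q_cong q n (word (l # u # us @ vs) 1) (word (u # us @ l # vs) (d * c))"
    unfolding word_mult by (auto intro: q_cong_trans)
  then show ?case by auto
qed

lemma word_cong_ordered_word:
  assumes "set ls \<subseteq> indets n"
  shows "\<exists>c. q_cong q n (word ls 1) (Poly_Mapping.single (ordered_word n (word_monomial ls)) c)"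
  using assms
proof (induction ls)
  case Nil
  have "ordered_word n 0 = FM []" by (simp add: ordered_word_def)
  then show ?case by (intro exI[of _ 1]) (simp add: q_cong_refl)
next
  case (Cons l ls)
  define m where "m = word_monomial ls"
  from Cons obtain c where c: "q_cong q n (word ls 1) (Poly_Mapping.single (ordered_word n m) c)"
    by (auto simp: m_def)
  obtain us vs where uv: "letters (ordered_word n m) = us @ vs"
    "letters (ordered_word n (m + Poly_Mapping.single l 1)) = us @ l # vs"
    "set us \<subseteq> indets n" "l \<in> range XVar \<longrightarrow> set us \<subseteq> range XVar"
    using ordered_word_insert[of l n m] Cons.prems by auto
  have w: "ordered_word n m = FM (us @ vs)" "ordered_word n (m + Poly_Mapping.single l 1) = FM (us @ l # vs)"
    using uv by (metis free_monoid.collapse)+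
  have "set (letters (ordered_word n m)) \<subseteq> indets n"
    using set_blocks[of n XVar m] set_blocks[of n YVar m]
    by (auto simp: letters_ordered_word indets_def)
  then have vs: "set vs \<subseteq> indets n" using uv by simp
  obtain d where d: "q_cong q n (word (l # us @ vs) 1) (word (us @ l # vs) d)"
    using move_letter[of l n us vs q] Cons.prems uv vs by auto
  have "q_cong q n (word [l] 1 * word ls 1) (word [l] 1 * word (us @ vs) c)"
    using Cons.prems c unfolding w by (intro q_cong_mult_left word_in_free_alg) auto
  moreover have "q_cong q n (word [] c * word (l # us @ vs) 1) (word [] c * word (us @ l # vs) d)"
    by (intro q_cong_mult_left word_in_free_alg d) simp
  ultimately have "q_cong q n (word (l # ls) 1) (word (us @ l # vs) (c * d))"
    unfolding word_mult by (auto intro: q_cong_trans)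
  moreover have "word_monomial (l # ls) = m + Poly_Mapping.single l 1" by (simp add: m_def add.commute)
  ultimately show ?case using w(2) by auto
qed

lemma q_cong_ordered_rep:
  assumes "a \<in> carrier (free_alg n)"
  shows "\<exists>p\<in>polys_on (indets n). q_cong q n a (ordered_rep n p)"
proof (induction a rule: poly_mapping_additive_induct)
  case zero
  show ?case by (intro bexI[of _ 0]) (auto simp: q_cong_refl polys_on_def)
next
  case (single w)
  then have w: "set (letters w) \<subseteq> indets n" using assms by (auto simp: free_alg_def)
  let ?m = "word_monomial (letters w)" and ?d = "Poly_Mapping.lookup a w"
  obtain c where "q_cong q n (word (letters w) 1) (Poly_Mapping.single (ordered_word n ?m) c)"
    using word_cong_ordered_word[OF w] by blast
  then have "q_cong q n (word [] ?d * word (letters w) 1)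
      (word [] ?d * Poly_Mapping.single (ordered_word n ?m) c)"
    by (intro q_cong_mult_left word_in_free_alg) simp_all
  then have "q_cong q n (Poly_Mapping.single w ?d) (ordered_rep n (Poly_Mapping.single ?m (?d * c)))"
    by (simp add: mult_single plus_free_monoid_def ordered_rep_single)
  moreover have "Poly_Mapping.single ?m (?d * c) \<in> polys_on (indets n)"
    using w by (intro polys_on_single) (simp add: keys_word_monomial)
  ultimately show ?case by blast
next
  case (add a b)
  then obtain p r where "p \<in> polys_on (indets n)" "q_cong q n a (ordered_rep n p)"
    "r \<in> polys_on (indets n)" "q_cong q n b (ordered_rep n r)" by blast
  moreover from this have "p + r \<in> polys_on (indets n)"
    using Poly_Mapping.keys_add[of p r] by (auto simp: polys_on_def)
  moreover from calculation have "q_cong q n (a + b) (ordered_rep n (p + r))"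
    unfolding ordered_rep_add by (intro q_cong_add)
  ultimately show ?case by blast
qed

text \<open>The relations say no more than \<open>normal_form\<close> sees: an element \<open>a\<close> is congruent to
some \<open>ordered_rep n p\<close>, and if \<open>a\<close> lies in the kernel then so does
\<open>ordered_rep n p\<close>, whose normal form is \<open>p\<close>. Thus the ordered monomials are a basis of
the quotient.\<close>

lemma q_ideal_eq_kernel:
  "q_ideal q n = {a \<in> carrier (free_alg n). normal_form q n a = 0}"
proof
  show "{a \<in> carrier (free_alg n). normal_form q n a = 0} \<subseteq> q_ideal q n"
  proof clarify
    fix a assume a: "a \<in> carrier (free_alg n)" "normal_form q n a = 0"
    obtain p where p: "p \<in> polys_on (indets n)" "q_cong q n a (ordered_rep n p)"
      using q_cong_ordered_rep[OF a(1)] by blast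
    then have "normal_form q n (a - ordered_rep n p) = 0"
      using q_ideal_subset_kernel by (auto simp: q_cong_def)
    then have "p = 0" using a p by (simp add: normal_form_diff normal_form_ordered_rep)
    then show "a \<in> q_ideal q n" using p by (simp add: q_cong_def)
  qed
qed (rule q_ideal_subset_kernel)

lemma coset_eq_iff:
  assumes "a \<in> carrier (free_alg n)" "b \<in> carrier (free_alg n)"
  shows "q_ideal q n +>\<^bsub>free_alg n\<^esub> a = q_ideal q n +>\<^bsub>free_alg n\<^esub> b \<longleftrightarrow>
    normal_form q n a = normal_form q n b"
proof -
  interpret ring "free_alg n :: (indet free_monoid \<Rightarrow>\<^sub>0 'a) ring" by (rule ring_free_alg)
  have mb: "- b \<in> carrier (free_alg n)" using assms by (simp add: free_alg_def)
  then have "\<ominus>\<^bsub>free_alg n\<^esub> b = - b"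
    using assms minus_equality[of "- b" b] by simp
  then have "a \<ominus>\<^bsub>free_alg n\<^esub> b = a - b" by (simp add: a_minus_def)
  moreover have "a - b \<in> carrier (free_alg n)" using free_alg_add[OF assms(1) mb] by simp
  ultimately show ?thesis
    using quotient_eq_iff_same_a_r_cos[OF ideal_q_ideal assms, of q]
    by (simp add: q_ideal_eq_kernel normal_form_diff)
qed

text \<open>The kernel being known, classes correspond to polynomials bijectively, sums of classes to sums and
products of classes to twisted products.\<close>

lemma to_q_alg_inj: "inj_on (to_q_alg q n) (polys_on (indets n))"
  by (rule inj_onI)
     (metis to_q_alg_def coset_eq_iff ordered_rep_in_free_alg normal_form_ordered_rep)

lemma to_q_alg_image: "to_q_alg q n ` polys_on (indets n) = carrier (q_alg q n)"
proof -
  have carrier: "carrier (q_alg q n) = (\<lambda>a. q_ideal q n +>\<^bsub>free_alg n\<^esub> a) ` carrier (free_alg n)"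
    unfolding q_alg_def FactRing_def A_RCOSETS_def' by auto
  have "q_ideal q n +>\<^bsub>free_alg n\<^esub> a \<in> to_q_alg q n ` polys_on (indets n)"
    if a: "a \<in> carrier (free_alg n)" for a
  proof (rule image_eqI)
    show "normal_form q n a \<in> polys_on (indets n)" using a by (rule normal_form_in_polys_on)
    then show "q_ideal q n +>\<^bsub>free_alg n\<^esub> a = to_q_alg q n (normal_form q n a)"
      unfolding to_q_alg_def using a
      by (simp add: coset_eq_iff ordered_rep_in_free_alg normal_form_ordered_rep)
  qed
  moreover have "to_q_alg q n p \<in> carrier (q_alg q n)" for p
    unfolding carrier to_q_alg_def by (intro imageI ordered_rep_in_free_alg)
  ultimately show ?thesis unfolding carrier by blast
qed

lemma to_q_alg_add:
  "to_q_alg q n (p + r) = to_q_alg q n p \<oplus>\<^bsub>q_alg q n\<^esub> to_q_alg q n r"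
  using ring_hom_add[OF ideal.rcos_ring_hom[OF ideal_q_ideal[of q n]] ordered_rep_in_free_alg ordered_rep_in_free_alg]
  by (simp add: to_q_alg_def q_alg_def ordered_rep_add)

lemma to_q_alg_mult:
  assumes "p \<in> polys_on (indets n)" "r \<in> polys_on (indets n)"
  shows "to_q_alg q n p \<otimes>\<^bsub>q_alg q n\<^esub> to_q_alg q n r =
    to_q_alg q n (twisted_mult (q_twist q n) p r)"
proof -
  let ?p = "ordered_rep n p" and ?r = "ordered_rep n r"
  have pr: "?p * ?r \<in> carrier (free_alg n)" by (intro free_alg_mult ordered_rep_in_free_alg)
  have nf: "normal_form q n (?p * ?r) = twisted_mult (q_twist q n) p r"
    using assms by (simp add: normal_form_mult normal_form_ordered_rep)
  then have "twisted_mult (q_twist q n) p r \<in> polys_on (indets n)"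
    using normal_form_in_polys_on[OF pr, of q] by simp
  then have "to_q_alg q n (twisted_mult (q_twist q n) p r) = q_ideal q n +>\<^bsub>free_alg n\<^esub> (?p * ?r)"
    unfolding to_q_alg_def using pr nf
    by (simp add: coset_eq_iff ordered_rep_in_free_alg normal_form_ordered_rep)
  then show ?thesis
    using ring_hom_mult[OF ideal.rcos_ring_hom[OF ideal_q_ideal[of q n]] ordered_rep_in_free_alg ordered_rep_in_free_alg]
    by (simp add: to_q_alg_def q_alg_def)
qed

lemma to_q_alg_zero: "to_q_alg q n 0 = \<zero>\<^bsub>q_alg q n\<^esub>"
  using ring_hom_zero[OF ideal.rcos_ring_hom[OF ideal_q_ideal[of q n]] ring_free_alg]
    ideal.quotient_is_ring[OF ideal_q_ideal[of q n]]
  by (simp add: to_q_alg_def q_alg_def)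

section \<open>The ideal generated by a bi-homogeneous element\<close>

definition bihomogeneous_poly :: "nat \<Rightarrow> nat \<times> nat \<Rightarrow> ((indet \<Rightarrow>\<^sub>0 nat) \<Rightarrow>\<^sub>0 'k::field) \<Rightarrow> bool" where
  "bihomogeneous_poly n d p \<longleftrightarrow> (\<forall>m\<in>Poly_Mapping.keys p. bidegree n m = d)"

definition bicomponent :: "nat \<Rightarrow> nat \<times> nat \<Rightarrow> ((indet \<Rightarrow>\<^sub>0 nat) \<Rightarrow>\<^sub>0 'k::field) \<Rightarrow> ((indet \<Rightarrow>\<^sub>0 nat) \<Rightarrow>\<^sub>0 'k)" where
  "bicomponent n d p =
     (\<Sum>m\<in>Poly_Mapping.keys p. if bidegree n m = d then Poly_Mapping.single m (Poly_Mapping.lookup p m) else 0)"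

lemma lookup_bicomponent:
  "Poly_Mapping.lookup (bicomponent n d p) m = (if bidegree n m = d then Poly_Mapping.lookup p m else 0)"
proof -
  have "Poly_Mapping.lookup (bicomponent n d p) m =
      (\<Sum>m'\<in>Poly_Mapping.keys p. if m' = m then (if bidegree n m = d then Poly_Mapping.lookup p m else 0) else 0)"
    unfolding bicomponent_def lookup_sum by (rule sum.cong) (auto simp: lookup_single)
  then show ?thesis by (simp add: in_keys_iff)
qed

lemma keys_bicomponent:
  "Poly_Mapping.keys (bicomponent n d p) = {m \<in> Poly_Mapping.keys p. bidegree n m = d}"
  by (auto simp: in_keys_iff lookup_bicomponent split: if_splits)

lemma bihomogeneous_bicomponent: "bihomogeneous_poly n d (bicomponent n d p)"
  by (auto simp: bihomogeneous_poly_def keys_bicomponent)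

lemma bicomponent_add: "bicomponent n d (p + r) = bicomponent n d p + bicomponent n d r"
  by (rule poly_mapping_eqI) (simp add: lookup_bicomponent lookup_add)

lemma bicomponent_bihomogeneous:
  assumes "bihomogeneous_poly n e p"
  shows "bicomponent n d p = (if d = e then p else 0)"
proof (rule poly_mapping_eqI)
  fix m
  have "Poly_Mapping.lookup p m = 0" if "bidegree n m \<noteq> e"
    using that assms by (auto simp: bihomogeneous_poly_def in_keys_iff)
  then show "Poly_Mapping.lookup (bicomponent n d p) m = Poly_Mapping.lookup (if d = e then p else 0) m"
    by (auto simp: lookup_bicomponent)
qed

lemma bicomponent_eq_0:
  "(\<And>m. m \<in> Poly_Mapping.keys p \<Longrightarrow> bidegree n m \<noteq> d) \<Longrightarrow> bicomponent n d p = 0"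
  by (rule poly_mapping_eqI) (auto simp: lookup_bicomponent in_keys_iff)

lemma bihomogeneous_poly_mult:
  assumes "bihomogeneous_poly n d p" "bihomogeneous_poly n e r"
  shows "bihomogeneous_poly n (fst d + fst e, snd d + snd e) (p * r)"
  unfolding bihomogeneous_poly_def
proof
  fix m assume "m \<in> Poly_Mapping.keys (p * r)"
  then obtain a b where "a \<in> Poly_Mapping.keys p" "b \<in> Poly_Mapping.keys r" "m = a + b"
    using Poly_Mapping.keys_mult[of p r] by blast
  then show "bidegree n m = (fst d + fst e, snd d + snd e)"
    using assms by (simp add: bihomogeneous_poly_def bidegree_add)
qed

lemma bihomogeneous_poly_single: "bihomogeneous_poly n (bidegree n m) (Poly_Mapping.single m c)"
  by (simp add: bihomogeneous_poly_def)

text \<open>On bi-homogeneous elements the twist is constant. This is what makes a bi-homogeneous \<open>f\<close>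
special: it commutes with every bi-homogeneous element up to a power of \<open>q\<close>.\<close>

lemma twisted_mult_bihomogeneous:
  assumes p: "bihomogeneous_poly n d p" and r: "bihomogeneous_poly n e r"
  shows "twisted_mult (q_twist q n) p r = Poly_Mapping.single 0 (q ^ (snd d * fst e)) * (p * r)"
proof (induction p rule: poly_mapping_additive_induct)
  case (single m)
  then have m: "bidegree n m = d" using p by (simp add: bihomogeneous_poly_def)
  show ?case
  proof (induction r rule: poly_mapping_additive_induct)
    case (single m')
    then have "bidegree n m' = e" using r by (simp add: bihomogeneous_poly_def)
    with m show ?case by (simp add: twisted_mult_single mult_single q_twist_def)
  qed (simp_all add: twisted_mult_add_right distrib_left)
qed (simp_all add: twisted_mult_add_left distrib_left distrib_right)

text \<open>The order on bi-degrees is lexicographic, hence total and compatible with addition.\<close>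

lemma bidegree_top_sum:
  fixes d e d' e' :: "nat \<times> nat"
  assumes "d \<le> d'" "e \<le> e'" "(fst d + fst e, snd d + snd e) = (fst d' + fst e', snd d' + snd e')"
  shows "d = d' \<and> e = e'"
  using assms by (auto simp: less_eq_prod_def prod_eq_iff)

text \<open>The generator of the ideal, as a polynomial. Its ordinary multiples will be shown to be the ideal that
it generates for the twisted product.\<close>

locale bihomogeneous_generator =
  fixes q :: "'k::field" and n :: nat and d :: "nat \<times> nat" and f :: "(indet \<Rightarrow>\<^sub>0 nat) \<Rightarrow>\<^sub>0 'k"
  assumes q: "q \<noteq> 0"
    and f: "f \<in> polys_on (indets n)" "bihomogeneous_poly n d f"
begin

abbreviation A :: "((indet \<Rightarrow>\<^sub>0 nat) \<Rightarrow>\<^sub>0 'k) set" where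
  "A \<equiv> polys_on (indets n)"

abbreviation star :: "((indet \<Rightarrow>\<^sub>0 nat) \<Rightarrow>\<^sub>0 'k) \<Rightarrow> _ \<Rightarrow> _" (infixl "\<star>" 70) where
  "p \<star> r \<equiv> twisted_mult (q_twist q n) p r"

lemma twisted_mult_in: "p \<in> A \<Longrightarrow> r \<in> A \<Longrightarrow> p \<star> r \<in> A"
  using normal_form_in_polys_on[of "ordered_rep n p * ordered_rep n r" n q]
  by (simp add: normal_form_mult normal_form_ordered_rep free_alg_mult ordered_rep_in_free_alg)

definition multiples :: "((indet \<Rightarrow>\<^sub>0 nat) \<Rightarrow>\<^sub>0 'k) set" where
  "multiples = {f * g | g. g \<in> A}"

sublocale A: sub_idom A
  by (rule sub_idom_polys_on)

lemma single_in: "p \<in> A \<Longrightarrow> m \<in> Poly_Mapping.keys p \<Longrightarrow> Poly_Mapping.single m c \<in> A"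
  by (intro polys_on_single) (auto simp: polys_on_def)

lemma scalar_in: "Poly_Mapping.single 0 c \<in> A"
  by (intro polys_on_single) simp

lemma multiplesI: "g \<in> A \<Longrightarrow> f * g \<in> multiples"
  by (auto simp: multiples_def)

lemma multiples_add: "a \<in> multiples \<Longrightarrow> b \<in> multiples \<Longrightarrow> a + b \<in> multiples"
  unfolding multiples_def by clarify (metis A.add_in distrib_left)

lemma multiples_zero: "0 \<in> multiples"
  using multiplesI[of 0] by simp

lemma multiples_subset: "multiples \<subseteq> A"
  using f by (auto simp: multiples_def A.mult_in)

lemma multiples_mult: "a \<in> multiples \<Longrightarrow> b \<in> A \<Longrightarrow> a * b \<in> multiples"
  unfolding multiples_def by clarify (metis A.mult_in mult.assoc)

lemma multiples_star_bihomogeneous: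
  assumes "bihomogeneous_poly n d' p" "bihomogeneous_poly n e' r" "p \<in> A" "r \<in> A"
    and "p \<in> multiples \<or> r \<in> multiples"
  shows "p \<star> r \<in> multiples"
proof -
  have "p * r \<in> multiples"
    using assms(3-5) multiples_mult[of p r] multiples_mult[of r p] by (auto simp: mult.commute)
  then show ?thesis
    unfolding twisted_mult_bihomogeneous[OF assms(1,2)]
    using multiples_mult[OF _ scalar_in] by (simp add: mult.commute)
qed

text \<open>Both arguments decompose into terms; a term \<open>m\<close> of the cofactor gives the bi-homogeneous
multiple \<open>f * m\<close>, whose twisted products with terms are scalar multiples of the ordinary ones.\<close>

lemma multiples_star:
  assumes "a \<in> A" "b \<in> multiples"
  shows "a \<star> b \<in> multiples" "b \<star> a \<in> multiples"
proof -
  obtain g where g: "g \<in> A" "b = f * g" using assms by (auto simp: multiples_def)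
  have "a \<star> (f * g) \<in> multiples \<and> (f * g) \<star> a \<in> multiples"
  proof (induction g rule: poly_mapping_additive_induct)
    case (single m)
    let ?g = "Poly_Mapping.single m (Poly_Mapping.lookup g m)"
    have g': "?g \<in> A" using g single by (intro single_in)
    have fg: "bihomogeneous_poly n (fst d + fst (bidegree n m), snd d + snd (bidegree n m)) (f * ?g)"
      by (intro bihomogeneous_poly_mult f bihomogeneous_poly_single)
    have mult: "f * ?g \<in> multiples" using g' by (rule multiplesI)
    then have fg_in: "f * ?g \<in> A" using multiples_subset by blast
    show ?case
    proof (induction a rule: poly_mapping_additive_induct)
      case (single m')
      then have "Poly_Mapping.single m' (Poly_Mapping.lookup a m') \<in> A" using assms by (intro single_in)
      then show ?case
        using multiples_star_bihomogeneous[OF bihomogeneous_poly_single fg]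
          multiples_star_bihomogeneous[OF fg bihomogeneous_poly_single] fg_in mult by blast
    qed (auto simp: multiples_zero twisted_mult_add_left twisted_mult_add_right intro: multiples_add)
  qed (auto simp: multiples_zero distrib_left twisted_mult_add_left twisted_mult_add_right intro: multiples_add)
  then show "a \<star> b \<in> multiples" "b \<star> a \<in> multiples" using g by simp_all
qed

lemma multiples_bicomponent:
  assumes "a \<in> multiples"
  shows "bicomponent n e a \<in> multiples"
proof -
  obtain g where g: "g \<in> A" "a = f * g" using assms by (auto simp: multiples_def)
  have "bicomponent n e (f * g) \<in> multiples"
  proof (induction g rule: poly_mapping_additive_induct)
    case zero
    show ?case using multiples_zero bicomponent_eq_0[of "f * 0" n e] by simp
  next
    case (single m)
    let ?g = "Poly_Mapping.single m (Poly_Mapping.lookup g m)"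
    have "f * ?g \<in> multiples" using g single by (intro multiplesI single_in)
    moreover have "bihomogeneous_poly n (fst d + fst (bidegree n m), snd d + snd (bidegree n m)) (f * ?g)"
      by (intro bihomogeneous_poly_mult f bihomogeneous_poly_single)
    ultimately show ?case using multiples_zero by (simp add: bicomponent_bihomogeneous)
  next
    case (add a b)
    then show ?case by (simp add: distrib_left bicomponent_add multiples_add)
  qed
  then show ?thesis using g by simp
qed

lemma bicomponent_in: "a \<in> A \<Longrightarrow> bicomponent n e a \<in> A"
  by (auto simp: polys_on_def keys_bicomponent)

text \<open>Only the top components of the factors contribute to the top component of a product, because a sum of
bi-degrees bounded by \<open>\<alpha>\<close> and \<open>\<beta>\<close> attains \<open>\<alpha> + \<beta>\<close> only at
the bounds.\<close>

lemma bicomponent_star_top: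
  assumes a: "\<And>m. m \<in> Poly_Mapping.keys a \<Longrightarrow> bidegree n m \<le> \<alpha>"
    and b: "\<And>m. m \<in> Poly_Mapping.keys b \<Longrightarrow> bidegree n m \<le> \<beta>"
  shows "bicomponent n (fst \<alpha> + fst \<beta>, snd \<alpha> + snd \<beta>) (a \<star> b) =
    bicomponent n \<alpha> a \<star> bicomponent n \<beta> b"
proof -
  let ?\<gamma> = "(fst \<alpha> + fst \<beta>, snd \<alpha> + snd \<beta>)"
  define a0 b0 where "a0 = a - bicomponent n \<alpha> a" and "b0 = b - bicomponent n \<beta> b"
  have a0: "m \<in> Poly_Mapping.keys a0 \<Longrightarrow> m \<in> Poly_Mapping.keys a \<and> bidegree n m \<noteq> \<alpha>" for m
    by (auto simp: a0_def in_keys_iff lookup_minus lookup_bicomponent split: if_splits)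
  have b0: "m \<in> Poly_Mapping.keys b0 \<Longrightarrow> m \<in> Poly_Mapping.keys b \<and> bidegree n m \<noteq> \<beta>" for m
    by (auto simp: b0_def in_keys_iff lookup_minus lookup_bicomponent split: if_splits)
  have vanish: "bicomponent n ?\<gamma> (u \<star> v) = 0"
    if u: "Poly_Mapping.keys u \<subseteq> Poly_Mapping.keys a" and v: "Poly_Mapping.keys v \<subseteq> Poly_Mapping.keys b"
      and uv: "(\<forall>m\<in>Poly_Mapping.keys u. bidegree n m \<noteq> \<alpha>) \<or> (\<forall>m\<in>Poly_Mapping.keys v. bidegree n m \<noteq> \<beta>)"
    for u v
  proof (rule bicomponent_eq_0)
    fix m assume "m \<in> Poly_Mapping.keys (u \<star> v)"
    then obtain m1 m2 where m: "m1 \<in> Poly_Mapping.keys u" "m2 \<in> Poly_Mapping.keys v" "m = m1 + m2"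
      using keys_twisted_mult by blast
    then have "bidegree n m1 \<le> \<alpha>" "bidegree n m2 \<le> \<beta>" using u v a b by blast+
    moreover have "bidegree n m1 \<noteq> \<alpha> \<or> bidegree n m2 \<noteq> \<beta>" using uv m by blast
    ultimately show "bidegree n m \<noteq> ?\<gamma>"
      unfolding m(3) bidegree_add using bidegree_top_sum by blast
  qed
  have split: "a = bicomponent n \<alpha> a + a0" "b = bicomponent n \<beta> b + b0"
    by (simp_all add: a0_def b0_def)
  have "a \<star> b = bicomponent n \<alpha> a \<star> b + a0 \<star> b"
    using twisted_mult_add_left[of "q_twist q n" "bicomponent n \<alpha> a" a0 b] split(1) by simp
  also have "bicomponent n \<alpha> a \<star> b =
      bicomponent n \<alpha> a \<star> bicomponent n \<beta> b + bicomponent n \<alpha> a \<star> b0"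
    using twisted_mult_add_right[of "q_twist q n" "bicomponent n \<alpha> a" "bicomponent n \<beta> b" b0] split(2) by simp
  finally have eq: "a \<star> b = bicomponent n \<alpha> a \<star> bicomponent n \<beta> b + bicomponent n \<alpha> a \<star> b0 + a0 \<star> b" .
  have "bicomponent n ?\<gamma> (bicomponent n \<alpha> a \<star> b0) = 0"
    by (rule vanish) (use b0 in \<open>auto simp: keys_bicomponent\<close>)
  moreover have "bicomponent n ?\<gamma> (a0 \<star> b) = 0"
    by (rule vanish) (use a0 in auto)
  moreover have "bihomogeneous_poly n ?\<gamma> (bicomponent n \<alpha> a \<star> bicomponent n \<beta> b)"
    unfolding bihomogeneous_poly_def
  proof
    fix m assume "m \<in> Poly_Mapping.keys (bicomponent n \<alpha> a \<star> bicomponent n \<beta> b)"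
    then obtain m1 m2 where "m1 \<in> Poly_Mapping.keys (bicomponent n \<alpha> a)"
      "m2 \<in> Poly_Mapping.keys (bicomponent n \<beta> b)" "m = m1 + m2"
      using keys_twisted_mult by blast
    then show "bidegree n m = ?\<gamma>" by (simp add: keys_bicomponent bidegree_add)
  qed
  ultimately show ?thesis
    unfolding eq bicomponent_add by (simp add: bicomponent_bihomogeneous)
qed

text \<open>Primality for the ordinary product implies primality for the twisted one. The top component of
\<open>a \<star> b\<close> lies in the ideal, which is graded, and up to a power of \<open>q\<close> it is the
ordinary product of the top components of \<open>a\<close> and \<open>b\<close>. So one of these lies in
the ideal; subtracting it leaves an element with fewer terms, to which induction applies.\<close>

lemma multiples_prime:
  assumes prime: "\<And>a b. a \<in> A \<Longrightarrow> b \<in> A \<Longrightarrow> a * b \<in> multiples \<Longrightarrow> a \<in> multiples \<or> b \<in> multiples"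
    and "a \<in> A" "b \<in> A" "a \<star> b \<in> multiples"
  shows "a \<in> multiples \<or> b \<in> multiples"
  using assms(2-)
proof (induction "card (Poly_Mapping.keys a) + card (Poly_Mapping.keys b)" arbitrary: a b rule: less_induct)
  case less
  show ?case
  proof (cases "a = 0 \<or> b = 0")
    case True
    then show ?thesis using multiples_zero by auto
  next
    case False
    define \<alpha> where "\<alpha> = Max (bidegree n ` Poly_Mapping.keys a)"
    define \<beta> where "\<beta> = Max (bidegree n ` Poly_Mapping.keys b)"
    let ?a = "bicomponent n \<alpha> a" and ?b = "bicomponent n \<beta> b"
    have nonempty: "bidegree n ` Poly_Mapping.keys a \<noteq> {}" "bidegree n ` Poly_Mapping.keys b \<noteq> {}"
      using False by simp_all
    have le: "m \<in> Poly_Mapping.keys a \<Longrightarrow> bidegree n m \<le> \<alpha>"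
      "m \<in> Poly_Mapping.keys b \<Longrightarrow> bidegree n m \<le> \<beta>" for m
      by (simp_all add: \<alpha>_def \<beta>_def)
    have attained: "\<alpha> \<in> bidegree n ` Poly_Mapping.keys a" "\<beta> \<in> bidegree n ` Poly_Mapping.keys b"
      using Max_in[OF _ nonempty(1)] Max_in[OF _ nonempty(2)] by (simp_all add: \<alpha>_def \<beta>_def)
    \<comment> \<open>Removing the top component shortens a polynomial since some term attains the maximum.\<close>
    have fewer: "card (Poly_Mapping.keys (c - bicomponent n \<gamma> c)) < card (Poly_Mapping.keys c)"
      if "\<gamma> \<in> bidegree n ` Poly_Mapping.keys c" for \<gamma> and c :: "(indet \<Rightarrow>\<^sub>0 nat) \<Rightarrow>\<^sub>0 'k"
    proof (rule psubset_card_mono)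
      have "Poly_Mapping.keys (c - bicomponent n \<gamma> c) = {m \<in> Poly_Mapping.keys c. bidegree n m \<noteq> \<gamma>}"
        by (auto simp: in_keys_iff lookup_minus lookup_bicomponent split: if_splits)
      then show "Poly_Mapping.keys (c - bicomponent n \<gamma> c) \<subset> Poly_Mapping.keys c" using that by auto
    qed simp
    have diff: "c - e \<in> multiples" if "c \<in> multiples" "e \<in> multiples" for c e
      using multiples_add[OF that(1) multiples_mult[OF that(2) A.uminus_in[OF A.one_in]]] by simp
    have restore: "c \<in> multiples" if "bicomponent n \<gamma> c \<in> multiples" "c - bicomponent n \<gamma> c \<in> multiples" for \<gamma> c
      using multiples_add[OF that] by simp
    have in_A: "?a \<in> A" "?b \<in> A" "a - ?a \<in> A" "b - ?b \<in> A"
      using less.prems by (auto intro: bicomponent_in A.diff_in)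
    have "?a \<star> ?b \<in> multiples"
      using multiples_bicomponent[OF less.prems(3)] bicomponent_star_top[OF le] by metis
    then have "Poly_Mapping.single 0 (q ^ (snd \<alpha> * fst \<beta>)) * (?a * ?b) \<in> multiples"
      by (simp add: twisted_mult_bihomogeneous[OF bihomogeneous_bicomponent bihomogeneous_bicomponent])
    then have "Poly_Mapping.single 0 (q ^ (snd \<alpha> * fst \<beta>)) * (?a * ?b) *
        Poly_Mapping.single 0 (inverse (q ^ (snd \<alpha> * fst \<beta>))) \<in> multiples"
      using scalar_in by (rule multiples_mult)
    moreover have "Poly_Mapping.single 0 (q ^ (snd \<alpha> * fst \<beta>)) * (?a * ?b) *
        Poly_Mapping.single 0 (inverse (q ^ (snd \<alpha> * fst \<beta>))) =
        (Poly_Mapping.single 0 (q ^ (snd \<alpha> * fst \<beta>)) *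
         Poly_Mapping.single 0 (inverse (q ^ (snd \<alpha> * fst \<beta>)))) * (?a * ?b)"
      by (simp only: mult_ac)
    ultimately have "?a * ?b \<in> multiples" using q by (simp add: mult_single)
    then consider "?a \<in> multiples" | "?b \<in> multiples" using prime in_A by blast
    then show ?thesis
    proof cases
      case 1
      have "(a - ?a) \<star> b = a \<star> b - ?a \<star> b"
        using twisted_mult_add_left[of "q_twist q n" "a - ?a" ?a b] by simp
      then have "(a - ?a) \<star> b \<in> multiples"
        using diff[OF less.prems(3) multiples_star(2)[OF less.prems(2) 1]] by simp
      then have "a - ?a \<in> multiples \<or> b \<in> multiples"
        using less.hyps[of "a - ?a" b] fewer[OF attained(1)] less.prems in_A by simp
      then show ?thesis using restore 1 by blast
    next
      case 2
      have "a \<star> (b - ?b) = a \<star> b - a \<star> ?b"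
        using twisted_mult_add_right[of "q_twist q n" a "b - ?b" ?b] by simp
      then have "a \<star> (b - ?b) \<in> multiples"
        using diff[OF less.prems(3) multiples_star(1)[OF less.prems(1) 2]] by simp
      then have "a \<in> multiples \<or> b - ?b \<in> multiples"
        using less.hyps[of a "b - ?b"] fewer[OF attained(2)] less.prems in_A by simp
      then show ?thesis using restore 2 by blast
    qed
  qed
qed

text \<open>Every ordinary multiple of \<open>f\<close> is a twisted left multiple: the power of \<open>q\<close> picked up
by a term \<open>m\<close> of the cofactor depends only on \<open>m\<close> and can be divided out of its
coefficient.\<close>

lemma untwist:
  assumes "g \<in> A"
  shows "\<exists>h\<in>A. h \<star> f = f * g"
proof (induction g rule: poly_mapping_additive_induct)
  case zero
  show ?case by (intro bexI[of _ 0]) auto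
next
  case (single m)
  let ?c = "Poly_Mapping.lookup g m" and ?e = "snd (bidegree n m) * fst d"
  let ?h = "Poly_Mapping.single m (inverse (q ^ ?e) * ?c)"
  have "?h \<star> f = Poly_Mapping.single 0 (q ^ ?e) * (?h * f)"
    by (rule twisted_mult_bihomogeneous[OF bihomogeneous_poly_single f(2)])
  also have "\<dots> = (Poly_Mapping.single 0 (q ^ ?e) * ?h) * f" by (simp only: mult.assoc)
  also have "Poly_Mapping.single 0 (q ^ ?e) * ?h = Poly_Mapping.single m ?c"
    using q unfolding mult_single mult.assoc[symmetric] by simp
  finally have "?h \<star> f = f * Poly_Mapping.single m ?c" by (simp add: mult.commute)
  moreover have "?h \<in> A" using assms single by (intro single_in)
  ultimately show ?case by blast
next
  case (add a b)
  then obtain h k where "h \<in> A" "h \<star> f = f * a" "k \<in> A" "k \<star> f = f * b" by blast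
  then have "h + k \<in> A" "(h + k) \<star> f = f * (a + b)"
    by (simp_all add: A.add_in twisted_mult_add_left distrib_left)
  then show ?case by blast
qed

lemma ideal_multiples: "ideal (to_q_alg q n ` multiples) (q_alg q n)"
proof (rule ideal_if_closed[OF ring_q_alg])
  show "to_q_alg q n ` multiples \<subseteq> carrier (q_alg q n)"
    using multiples_subset to_q_alg_image by blast
  show "\<zero>\<^bsub>q_alg q n\<^esub> \<in> to_q_alg q n ` multiples"
    using multiples_zero to_q_alg_zero by (metis imageI)
  show "a \<oplus>\<^bsub>q_alg q n\<^esub> b \<in> to_q_alg q n ` multiples"
    if "a \<in> to_q_alg q n ` multiples" "b \<in> to_q_alg q n ` multiples" for a b
    using that multiples_add by (auto simp flip: to_q_alg_add)
  fix a x assume a: "a \<in> to_q_alg q n ` multiples" and x: "x \<in> carrier (q_alg q n)"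
  obtain p where p: "p \<in> multiples" "a = to_q_alg q n p" using a by blast
  obtain r where r: "r \<in> A" "x = to_q_alg q n r" using x to_q_alg_image by blast
  have "p \<in> A" using p multiples_subset by blast
  then show "x \<otimes>\<^bsub>q_alg q n\<^esub> a \<in> to_q_alg q n ` multiples" "a \<otimes>\<^bsub>q_alg q n\<^esub> x \<in> to_q_alg q n ` multiples"
    using p r multiples_star[OF r(1) p(1)] by (simp_all add: to_q_alg_mult)
qed

text \<open>One inclusion holds because the multiples form an ideal for the twisted product, the other because
each of them is a twisted left multiple of \<open>f\<close>.\<close>

lemma genideal_eq_multiples: "Idl\<^bsub>q_alg q n\<^esub> {to_q_alg q n f} = to_q_alg q n ` multiples"
proof
  interpret ring "q_alg q n" by (rule ring_q_alg)
  have f_carrier: "to_q_alg q n f \<in> carrier (q_alg q n)" using f to_q_alg_image by blast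
  have "f \<in> multiples" using multiplesI[of 1] by simp
  then show "Idl\<^bsub>q_alg q n\<^esub> {to_q_alg q n f} \<subseteq> to_q_alg q n ` multiples"
    by (intro genideal_minimal ideal_multiples) simp
  show "to_q_alg q n ` multiples \<subseteq> Idl\<^bsub>q_alg q n\<^esub> {to_q_alg q n f}"
  proof clarify
    fix p assume "p \<in> multiples"
    then obtain g where "g \<in> A" "p = f * g" by (auto simp: multiples_def)
    then obtain h where h: "h \<in> A" "h \<star> f = p" using untwist by metis
    then have "to_q_alg q n p = to_q_alg q n h \<otimes>\<^bsub>q_alg q n\<^esub> to_q_alg q n f"
      using f by (simp add: to_q_alg_mult)
    moreover have "to_q_alg q n h \<in> carrier (q_alg q n)" using h to_q_alg_image by blast
    ultimately show "to_q_alg q n p \<in> Idl\<^bsub>q_alg q n\<^esub> {to_q_alg q n f}"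
      using ideal.I_l_closed[OF genideal_ideal genideal_self'[OF f_carrier]] f_carrier by simp
  qed
qed

end

section \<open>Primality\<close>

theorem theorem2:
  fixes q :: "'k::field" and n :: nat and f :: "(indet free_monoid \<Rightarrow>\<^sub>0 'k) set"
  assumes q_nonzero: "q \<noteq> 0"
    and q_not_root_of_unity: "\<And>m::nat. m > 0 \<Longrightarrow> q ^ m \<noteq> 1"
    and f_in: "f \<in> carrier (q_alg q n)"
    and f_bihomogeneous: "bihomogeneous q n f"
    and f_irreducible: "ring_irreducible\<^bsub>poly_alg n\<^esub> (from_q_alg q n f)"
  shows "prime_two_sided_ideal (Idl\<^bsub>q_alg q n\<^esub> {f}) (q_alg q n)"
proof -
  obtain d p where p: "p \<in> polys_on (indets n)" "bihomogeneous_poly n d p" and f_eq: "f = to_q_alg q n p"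
    using f_bihomogeneous by (auto simp: bihomogeneous_def bihomogeneous_poly_def carrier_poly_alg)
  interpret bihomogeneous_generator q n d p
    using q_nonzero p by unfold_locales
  have "from_q_alg q n f = p"
    unfolding from_q_alg_def carrier_poly_alg f_eq using to_q_alg_inj p(1) by (rule inv_into_f_f)
  then have irr: "irreducible_in A p"
    using f_irreducible p by (intro irreducible_in_if_ring_irreducible) simp_all
  interpret factorial_sub_idom A
    using finite_indets by (rule factorial_polys_on)
  have "prime_in A p" using irr by (rule irreducible_imp_prime_in)
  then have prime: "a \<in> multiples \<or> b \<in> multiples" if "a \<in> A" "b \<in> A" "a * b \<in> multiples" for a b
    using that unfolding prime_in_def divides_in_def multiples_def by blast
  have inj: "x \<in> multiples" if "to_q_alg q n x \<in> to_q_alg q n ` multiples" "x \<in> A" for x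
    using that to_q_alg_inj multiples_subset by (metis inj_on_image_mem_iff)
  have "1 \<notin> multiples"
    using irr p by (auto simp: multiples_def irreducible_in_def unit_in_def)
  then have "to_q_alg q n 1 \<notin> to_q_alg q n ` multiples" using inj A.one_in by blast
  moreover have "to_q_alg q n 1 \<in> carrier (q_alg q n)" using to_q_alg_image A.one_in by blast
  ultimately have proper: "to_q_alg q n ` multiples \<noteq> carrier (q_alg q n)" by blast
  have "a \<in> to_q_alg q n ` multiples \<or> b \<in> to_q_alg q n ` multiples"
    if a: "a \<in> carrier (q_alg q n)" and b: "b \<in> carrier (q_alg q n)" and ab: "a \<otimes>\<^bsub>q_alg q n\<^esub> b \<in> to_q_alg q n ` multiples" for a b
  proof -
    obtain u v where u: "u \<in> A" "a = to_q_alg q n u" and v: "v \<in> A" "b = to_q_alg q n v"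
      using a b unfolding to_q_alg_image[symmetric] by blast
    have "to_q_alg q n (u \<star> v) \<in> to_q_alg q n ` multiples"
      using ab u v by (simp add: to_q_alg_mult)
    then have "u \<star> v \<in> multiples"
      by (rule inj) (rule twisted_mult_in[OF u(1) v(1)])
    then have "u \<in> multiples \<or> v \<in> multiples"
      by (rule multiples_prime[OF _ u(1) v(1), rotated]) (erule (2) prime)
    then show ?thesis unfolding u(2) v(2) by blast
  qed
  then show ?thesis
    unfolding prime_two_sided_ideal_def f_eq genideal_eq_multiples
    using ideal_multiples proper by blast
qed

end
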